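(* Let $\mathbb{K}$ be a field with characteristic different from $2$, let $\alpha \in \mathbb{K}\setminus\{0\}$, let $n \geq 1$ and let $A \in \mathrm{M}_n(\mathbb{K})$. Then $A$ is an $(\alpha,-\alpha)$-composite (in $\mathrm{M}_n(\mathbb{K})$) if and only if all the following conditions hold: (i) The sequences $(n_k(A,\alpha))_{k \geq 1}$ and $(n_k(A,-\alpha))_{k \geq 1}$ are intertwined. (ii) For every $\lambda \in \overline{\mathbb{K}} \setminus \{0,\alpha,-\alpha\}$ and every integer $k \geq 1$, $j_k(A,\lambda)=j_k(A,-\lambda)$.
   Context: $\overline{\mathbb{K}}$ is an algebraic closure of $\mathbb{K}$. For scalars $a,b \in \mathbb{K}\setminus\{0\}$, an element $x$ of a $\mathbb{K}$-algebra $\mathcal{A}$ is an $(a,b)$-composite if there are idempotents $p,q \in \mathcal{A}$ (i.e. $p^2=p$, $q^2=q$) with $x = a p + b q$. For $A \in \mathrm{M}_n(\mathbb{K})$, $\lambda\in\overline{\mathbb{K}}$ and an integer $k\geq 1$, $n_k(A,\lambda) := \dim \operatorname{Ker}(A-\lambda I_n)^k - \dim\operatorname{Ker}(A-\lambda I_n)^{k-1}$ (dimensions over $\overline{\mathbb{K}}$), i.e. the number of Jordan blocks of size at least $k$ for $\lambda$ in the Jordan reduction of $A$ over $\overline{\mathbb{K}}$ (zero if $\lambda$ is not an eigenvalue); $j_k(A,\lambda)$ is the number of Jordan blocks of size exactly $k$ for $\lambda$ in that Jordan reduction. Two sequences $(u_k)_{k\geq 1}$ and $(v_k)_{k\geq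 1}$ are intertwined if for all $k \geq 1$: $v_{k+1} \leq u_k$ and $u_{k+1} \leq v_k$. *)

theory Defs
  imports
    "HOL-Algebra.Algebraic_Closure_Type"
    "Jordan_Normal_Form.Jordan_Normal_Form_Uniqueness"
begin

definition mat_idempotent :: "nat \<Rightarrow> 'a::field mat \<Rightarrow> bool" where
  "mat_idempotent n p \<longleftrightarrow> p \<in> carrier_mat n n \<and> p * p = p"

text \<open>The notion of an \<open>(a, b)\<close>-composite, for the algebra of square matrices of size \<open>n\<close>.\<close>

definition mat_composite :: "nat \<Rightarrow> 'a::field \<Rightarrow> 'a \<Rightarrow> 'a mat \<Rightarrow> bool" where
  "mat_composite n a b M \<longleftrightarrow>
     (\<exists>p q. mat_idempotent n p \<and> mat_idempotent n q \<and> M = a \<cdot>\<^sub>m p + b \<cdot>\<^sub>m q)"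

text \<open>
  Matrices over \<open>'a\<close> are mapped entrywise into the algebraic closure, and kernels and
  Jordan blocks are taken there. \<open>dim_gen_eigenspace M \<mu> k\<close> is the dimension of the kernel
  of \<open>(M - \<mu> I)\<^sup>k\<close>.
\<close>

definition mat_ac :: "'a::field mat \<Rightarrow> 'a alg_closure mat" where
  "mat_ac A = map_mat to_ac A"

text \<open>
  Only meaningful for \<open>k \<ge> 1\<close>; the kernels increase with the exponent, so the subtraction
  on \<open>nat\<close> does not truncate.
\<close>

definition nk :: "'a::field mat \<Rightarrow> 'a alg_closure \<Rightarrow> nat \<Rightarrow> nat" where
  "nk A \<mu> k = dim_gen_eigenspace (mat_ac A) \<mu> k - dim_gen_eigenspace (mat_ac A) \<mu> (k - 1)"

definition jordan_blocks :: "'a::field mat \<Rightarrow> (nat \<times> 'a alg_closure) list" where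
  "jordan_blocks A = (SOME n_as. jordan_nf (mat_ac A) n_as)"

definition jk :: "'a::field mat \<Rightarrow> 'a alg_closure \<Rightarrow> nat \<Rightarrow> nat" where
  "jk A \<mu> k = length (filter ((=) (k, \<mu>)) (jordan_blocks A))"

text \<open>The number of blocks does not depend on the Jordan reduction that was chosen.\<close>

lemma jk_eq:
  assumes "jordan_nf (mat_ac A) n_as" and "k \<ge> 1"
  shows "jk A \<mu> k = length (filter ((=) (k, \<mu>)) n_as)"
proof -
  have "jordan_nf (mat_ac A) (jordan_blocks A)"
    unfolding jordan_blocks_def using assms(1) by (rule someI)
  from compute_nr_of_jordan_blocks[OF this, of k \<mu>]
    and compute_nr_of_jordan_blocks[OF assms(1), of k \<mu>]
  show ?thesis using assms(2) by (simp add: jk_def)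
qed

text \<open>Sequences are indexed from 1; their value at 0 is irrelevant.\<close>

definition intertwined :: "(nat \<Rightarrow> nat) \<Rightarrow> (nat \<Rightarrow> nat) \<Rightarrow> bool" where
  "intertwined u v \<longleftrightarrow> (\<forall>k\<ge>1. v (k + 1) \<le> u k \<and> u (k + 1) \<le> v k)"

end

theory Submission
  imports
    Defs
    "Jordan_Normal_Form.DL_Rank"
    "Jordan_Normal_Form.Jordan_Normal_Form_Existence"
begin

text \<open>
Write \<open>x = \<alpha> (p - q)\<close> for idempotents \<open>p\<close>, \<open>q\<close> and put \<open>s = \<alpha> (p + q - 1)\<close>. Then \<open>s\<close> anticommutes
with \<open>x\<close> and \<open>s\<^sup>2 = \<alpha>\<^sup>2 - x\<^sup>2\<close>. Conversely, since \<open>2\<close> and \<open>\<alpha>\<close> are invertible, such an \<open>s\<close> yields the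
idempotents \<open>p = (\<alpha> + x + s) / 2\<alpha>\<close> and \<open>q = (\<alpha> - x + s) / 2\<alpha>\<close>. So the question is which matrices
\<open>A\<close> admit a matrix \<open>S\<close> with \<open>S A = - A S\<close> and \<open>S\<^sup>2 = \<alpha>\<^sup>2 - A\<^sup>2\<close>
(\<open>composite_imp_anticommuting\<close>, \<open>anticommuting_imp_composite\<close>).

Necessity is a statement about dimensions of kernels of polynomials in \<open>A\<close> over the algebraic
closure. As \<open>S (A - \<mu>) = - (A + \<mu>) S\<close>, the matrix \<open>S\<close> carries the generalized eigenspace of \<open>\<mu>\<close>
to that of \<open>-\<mu>\<close>, and the composite of the two passages is \<open>\<alpha>\<^sup>2 - A\<^sup>2\<close>. If \<open>\<mu> \<noteq> \<plusminus>\<alpha>\<close>, this composite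
is invertible there, so the Jordan blocks of \<open>\<mu>\<close> and \<open>-\<mu>\<close> match. If \<open>\<mu> = \<plusminus>\<alpha>\<close>, it is the nilpotent
part \<open>A - \<mu>\<close> up to an invertible factor, so the block sizes of \<open>\<alpha>\<close> and \<open>-\<alpha>\<close>, matched in
decreasing order, differ by at most one. Both cases come out of one inequality
(\<open>nullity_anticommute\<close>), which is two applications of the Frobenius rank inequality
\<open>kernel_dim_frobenius\<close>.

Sufficiency must produce \<open>S\<close> over the ground field, where the eigenvalues need not live. For this
\<open>A\<close> is split over the ground field into a companion block of its minimal polynomial \<open>f\<close> and a rest
\<open>B\<close> (\<open>companion_splitting\<close>). For every \<open>\<mu>\<close>, the companion block carries exactly the largest Jordan
block of \<open>\<mu>\<close>, of size \<open>order \<mu> f\<close>; hence passing from \<open>A\<close> to \<open>B\<close> lowers the positive numbers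
\<open>n\<^sub>k(A, \<mu>)\<close> by one, which preserves the two conditions, and induction provides \<open>S\<close> on \<open>B\<close>. On
the companion block, the conditions say that \<open>order \<mu> f = order (-\<mu>) f\<close> for \<open>\<mu> \<noteq> \<plusminus>\<alpha>\<close> and that the
orders at \<open>\<alpha>\<close> and \<open>-\<alpha>\<close> differ by at most one, that is, \<open>f\<close> divides \<open>(\<alpha> + X) f(-X)\<close> or
\<open>(\<alpha> - X) f(-X)\<close>. With \<open>w = \<alpha> \<plusminus> X\<close> chosen accordingly, \<open>g(X) \<mapsto> w(X) g(-X)\<close> is then well defined
on \<open>K[X]/(f)\<close>; it anticommutes with multiplication by \<open>X\<close>, and its square is multiplication by
\<open>w(X) w(-X) = \<alpha>\<^sup>2 - X\<^sup>2\<close> (\<open>companion_anticommuting\<close>).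
\<close>

section \<open>Evaluating polynomials at a matrix\<close>

text \<open>
  Horner's scheme, so that induction over the coefficients follows the recursion.
\<close>

definition poly_mat :: "'a :: field mat \<Rightarrow> 'a poly \<Rightarrow> 'a mat" where
  "poly_mat A p = fold_coeffs (\<lambda>c M. c \<cdot>\<^sub>m 1\<^sub>m (dim_row A) + A * M) p (0\<^sub>m (dim_row A) (dim_row A))"

lemma poly_mat_0: "A \<in> carrier_mat n n \<Longrightarrow> poly_mat A 0 = 0\<^sub>m n n"
  by (simp add: poly_mat_def)

lemma poly_mat_pCons:
  assumes "A \<in> carrier_mat n n"
  shows "poly_mat A (pCons c p) = c \<cdot>\<^sub>m 1\<^sub>m n + A * poly_mat A p"
proof (cases "c = 0 \<and> p = 0")
  case True
  then show ?thesis using assms by (auto simp: poly_mat_def)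
next
  case False
  then show ?thesis using assms by (auto simp: poly_mat_def fold_coeffs_pCons_eq)
qed

lemma poly_mat_carrier [simp, intro]: "A \<in> carrier_mat n n \<Longrightarrow> poly_mat A p \<in> carrier_mat n n"
  by (induct p) (auto simp: poly_mat_0 poly_mat_pCons)

lemma poly_mat_dim [simp]:
  assumes "A \<in> carrier_mat n n"
  shows "dim_row (poly_mat A p) = n" "dim_col (poly_mat A p) = n"
  using poly_mat_carrier[OF assms, of p] by auto

lemma poly_mat_const: "A \<in> carrier_mat n n \<Longrightarrow> poly_mat A [:c:] = c \<cdot>\<^sub>m 1\<^sub>m n"
  by (auto simp: poly_mat_pCons poly_mat_0)

lemma poly_mat_1 [simp]: "A \<in> carrier_mat n n \<Longrightarrow> poly_mat A 1 = 1\<^sub>m n"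
  by (simp add: one_pCons poly_mat_const) (intro eq_matI, auto)

lemma poly_mat_X [simp]: "A \<in> carrier_mat n n \<Longrightarrow> poly_mat A [:0, 1:] = A"
  by (auto simp: poly_mat_pCons poly_mat_0)

lemma poly_mat_add:
  assumes A: "A \<in> carrier_mat n n"
  shows "poly_mat A (p + q) = poly_mat A p + poly_mat A q"
proof (induct p q rule: poly_induct2)
  case 0
  then show ?case using A by (simp add: poly_mat_0)
next
  case (pCons a p b q)
  have c: "poly_mat A p \<in> carrier_mat n n" "poly_mat A q \<in> carrier_mat n n" using A by auto
  show ?case
    unfolding add_pCons poly_mat_pCons[OF A] pCons mult_add_distrib_mat[OF A c]
    using A c by (intro eq_matI) (auto simp: algebra_simps)
qed

lemma poly_mat_smult:
  assumes A: "A \<in> carrier_mat n n"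
  shows "poly_mat A (smult a p) = a \<cdot>\<^sub>m poly_mat A p"
proof (induct p)
  case 0
  then show ?case using A by (simp add: poly_mat_0)
next
  case (pCons b p)
  have c: "poly_mat A p \<in> carrier_mat n n" using A by auto
  show ?case
    unfolding smult_pCons poly_mat_pCons[OF A] pCons mult_smult_distrib[OF A c]
    using A c by (intro eq_matI) (auto simp: algebra_simps)
qed

lemma poly_mat_uminus:
  assumes A: "A \<in> carrier_mat n n"
  shows "poly_mat A (- p) = - poly_mat A p"
proof -
  have "poly_mat A (- p) = (-1) \<cdot>\<^sub>m poly_mat A p"
    using poly_mat_smult[OF A, of "-1" p] by simp
  also have "\<dots> = - poly_mat A p" using A by (intro eq_matI) auto
  finally show ?thesis .
qed

lemma poly_mat_mult:
  assumes A: "A \<in> carrier_mat n n"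
  shows "poly_mat A (p * q) = poly_mat A p * poly_mat A q"
proof (induct p)
  case 0
  have "poly_mat A q \<in> carrier_mat n n" using A by auto
  then show ?case using A by (simp add: poly_mat_0)
next
  case (pCons b p)
  have c: "poly_mat A p \<in> carrier_mat n n" "poly_mat A q \<in> carrier_mat n n" using A by auto
  have "poly_mat A (pCons b p * q) = b \<cdot>\<^sub>m poly_mat A q + A * (poly_mat A p * poly_mat A q)"
    unfolding mult_pCons_left poly_mat_add[OF A] poly_mat_smult[OF A] poly_mat_pCons[OF A] pCons(2)
    using A c by (intro eq_matI) auto
  also have "A * (poly_mat A p * poly_mat A q) = A * poly_mat A p * poly_mat A q"
    by (rule assoc_mult_mat[symmetric, OF A c])
  also have "b \<cdot>\<^sub>m poly_mat A q = (b \<cdot>\<^sub>m 1\<^sub>m n) * poly_mat A q"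
    using c by (subst mult_smult_assoc_mat[of _ n n]) auto
  also have "\<dots> + A * poly_mat A p * poly_mat A q = (b \<cdot>\<^sub>m 1\<^sub>m n + A * poly_mat A p) * poly_mat A q"
    using c A by (subst add_mult_distrib_mat[of _ n n]) auto
  finally show ?case using A by (simp add: poly_mat_pCons)
qed

lemma poly_mat_commute:
  assumes A: "A \<in> carrier_mat n n"
  shows "poly_mat A p * poly_mat A q = poly_mat A q * poly_mat A p"
  using poly_mat_mult[OF A, of p q] poly_mat_mult[OF A, of q p] by (simp add: mult.commute)

lemma poly_mat_power:
  assumes A: "A \<in> carrier_mat n n"
  shows "poly_mat A (p ^ k) = poly_mat A p ^\<^sub>m k"
proof (induct k)
  case (Suc k)
  show ?case unfolding power_Suc2 poly_mat_mult[OF A] Suc by simp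
qed (use A in auto)

lemma poly_mat_char_matrix:
  assumes A: "A \<in> carrier_mat n n"
  shows "poly_mat A [:- e, 1:] = char_matrix A e"
  unfolding char_matrix_def poly_mat_pCons[OF A] poly_mat_0[OF A]
  using A by (intro eq_matI) auto

text \<open>
  With \<open>Q\<close> invertible this is invariance under similarity, and with \<open>B = - A\<close> it describes how a
  matrix that anticommutes with \<open>A\<close> moves past polynomials in \<open>A\<close>.
\<close>

lemma poly_mat_intertwine:
  assumes A: "A \<in> carrier_mat n n" and B: "B \<in> carrier_mat m m" and Q: "Q \<in> carrier_mat n m"
    and AQ: "A * Q = Q * B"
  shows "poly_mat A p * Q = Q * poly_mat B p"
proof (induct p)
  case 0
  then show ?case using A B Q by (simp add: poly_mat_0)
next
  case (pCons b p)
  have c: "poly_mat A p \<in> carrier_mat n n" "poly_mat B p \<in> carrier_mat m m" using A B by auto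
  have "poly_mat A (pCons b p) * Q = (b \<cdot>\<^sub>m 1\<^sub>m n) * Q + A * poly_mat A p * Q"
    unfolding poly_mat_pCons[OF A] using A c Q by (subst add_mult_distrib_mat[of _ n n]) auto
  also have "A * poly_mat A p * Q = A * (Q * poly_mat B p)"
    unfolding pCons(2)[symmetric] by (rule assoc_mult_mat[OF A c(1) Q])
  also have "\<dots> = Q * (B * poly_mat B p)"
    unfolding assoc_mult_mat[OF A Q c(2), symmetric] AQ by (rule assoc_mult_mat[OF Q B c(2)])
  also have "(b \<cdot>\<^sub>m 1\<^sub>m n) * Q = Q * (b \<cdot>\<^sub>m 1\<^sub>m m)"
    using Q by (simp add: mult_smult_assoc_mat[of _ n n] mult_smult_distrib[OF Q one_carrier_mat])
  also have "\<dots> + Q * (B * poly_mat B p) = Q * poly_mat B (pCons b p)"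
    unfolding poly_mat_pCons[OF B] using B c Q by (subst mult_add_distrib_mat[of _ n m]) auto
  finally show ?case .
qed

text \<open>
  The substitution \<open>X \<mapsto> - X\<close>, an involution of the polynomial ring.
\<close>

abbreviation reflect :: "'a::field poly \<Rightarrow> 'a poly" where
  "reflect p \<equiv> pcompose p [:0, -1:]"

lemma reflect_reflect: "reflect (reflect p) = p"
  by (simp flip: pcompose_assoc add: pcompose_pCons pcompose_idR)

lemma poly_mat_neg:
  assumes A: "A \<in> carrier_mat n n"
  shows "poly_mat (- A) p = poly_mat A (reflect p)"
proof -
  have mA: "- A \<in> carrier_mat n n" using A by auto
  show ?thesis
  proof (induct p)
    case 0
    then show ?case using A mA by (simp add: poly_mat_0)
  next
    case (pCons b p)
    have c: "poly_mat A (reflect p) \<in> carrier_mat n n" using A by auto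
    have x: "poly_mat A [:0, -1:] = - A"
      using poly_mat_uminus[OF A, of "[:0,1:]"] A by simp
    show ?case
      unfolding pcompose_pCons poly_mat_pCons[OF mA] pCons poly_mat_add[OF A] poly_mat_mult[OF A]
        poly_mat_const[OF A] x ..
  qed
qed

lemma poly_mat_four_block:
  assumes A: "A \<in> carrier_mat n n" and B: "B \<in> carrier_mat m m"
  shows "poly_mat (four_block_mat A (0\<^sub>m n m) (0\<^sub>m m n) B) p =
    four_block_mat (poly_mat A p) (0\<^sub>m n m) (0\<^sub>m m n) (poly_mat B p)"
proof -
  have F: "four_block_mat A (0\<^sub>m n m) (0\<^sub>m m n) B \<in> carrier_mat (n + m) (n + m)"
    using A B by auto
  show ?thesis
  proof (induct p)
    case 0
    then show ?case using A B poly_mat_0[OF F] by (simp add: poly_mat_0)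
  next
    case (pCons b p)
    have c: "poly_mat A p \<in> carrier_mat n n" "poly_mat B p \<in> carrier_mat m m" using A B by auto
    show ?case
      unfolding poly_mat_pCons[OF F] pCons poly_mat_pCons[OF A] poly_mat_pCons[OF B]
      using A B c
      by (subst mult_four_block_mat[of _ n n _ m _ m _ _ n _ m]) (auto intro!: eq_matI)
  qed
qed

lemma poly_mat_map:
  assumes A: "A \<in> carrier_mat n n"
  shows "poly_mat (map_mat to_ac A) (map_poly to_ac p) = map_mat to_ac (poly_mat A p)"
proof -
  have A': "map_mat to_ac A \<in> carrier_mat n n" using A by auto
  interpret semiring_hom "to_ac :: 'a \<Rightarrow> 'a alg_closure" by unfold_locales auto
  show ?thesis
  proof (induct p)
    case 0
    then show ?case using A A' by (auto simp: poly_mat_0)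
  next
    case (pCons b p)
    have c: "poly_mat A p \<in> carrier_mat n n" using A by auto
    have "map_poly to_ac (pCons b p) = pCons (to_ac b) (map_poly to_ac p)"
      by (intro poly_eqI) (auto simp: coeff_map_poly coeff_pCons split: nat.splits)
    moreover have "mat_hom (b \<cdot>\<^sub>m 1\<^sub>m n + Y) = to_ac b \<cdot>\<^sub>m 1\<^sub>m n + mat_hom Y"
      if "Y \<in> carrier_mat n n" for Y using that by (intro eq_matI) auto
    ultimately show ?case
      using A c by (simp add: poly_mat_pCons[OF A] poly_mat_pCons[OF A'] pCons(2) mat_hom_mult[OF A c])
  qed
qed

lemma poly_mat_index:
  assumes A: "A \<in> carrier_mat n n" and ij: "i < n" "j < n" and N: "degree p \<le> N"
  shows "poly_mat A p $$ (i, j) = (\<Sum>k\<le>N. coeff p k * (A ^\<^sub>m k) $$ (i, j))"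
  using N ij
proof (induct p arbitrary: N i)
  case 0
  then show ?case using A by (simp add: poly_mat_0)
next
  case (pCons b p)
  have c: "poly_mat A p \<in> carrier_mat n n" using A by auto
  have pw: "A ^\<^sub>m k \<in> carrier_mat n n" for k using A by auto
  have sA: "A * A ^\<^sub>m k = A ^\<^sub>m Suc k" for k
    using poly_mat_mult[OF A, of "[:0,1:]" "[:0,1:]^k"] poly_mat_power[OF A, of "[:0,1:]"] A
    by (metis poly_mat_X power_Suc)
  have s1: "poly_mat A (pCons b p) $$ (i,j) = b * 1\<^sub>m n $$ (i,j) + (\<Sum>l<n. A $$ (i,l) * poly_mat A p $$ (l,j))"
    unfolding poly_mat_pCons[OF A] using A c pCons(4,5)
    by (auto simp: scalar_prod_def lessThan_atLeast0)
  show ?case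
  proof (cases N)
    case 0
    then have "p = 0" using pCons(3) by (auto split: if_splits)
    then show ?thesis using s1 A 0 pCons(4,5) by (simp add: poly_mat_0)
  next
    case (Suc N')
    have d: "degree p \<le> N'" using pCons(3) Suc by (cases "p = 0") auto
    have "(\<Sum>l<n. A $$ (i,l) * poly_mat A p $$ (l,j))
      = (\<Sum>l<n. \<Sum>k\<le>N'. coeff p k * (A $$ (i,l) * (A ^\<^sub>m k) $$ (l, j)))"
      using pCons(2)[OF d _ pCons(5)] by (intro sum.cong) (auto simp: sum_distrib_left algebra_simps)
    also have "\<dots> = (\<Sum>k\<le>N'. coeff p k * (\<Sum>l<n. A $$ (i,l) * (A ^\<^sub>m k) $$ (l, j)))"
      by (subst sum.swap) (simp add: sum_distrib_left)
    also have "\<dots> = (\<Sum>k\<le>N'. coeff p k * (A ^\<^sub>m Suc k) $$ (i, j))"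
      unfolding sA[symmetric] using A pw pCons(4,5)
      by (intro sum.cong) (auto simp: scalar_prod_def lessThan_atLeast0)
    finally show ?thesis
      unfolding s1 Suc sum.atMost_Suc_shift using A by simp
  qed
qed

section \<open>Kernel dimensions and the Frobenius inequality\<close>

abbreviation vsub :: "'a::field itself \<Rightarrow> nat \<Rightarrow> 'a vec set \<Rightarrow> ('a, 'a vec) module" where
  "vsub ty n U \<equiv> (module_vec ty n)\<lparr>carrier := U\<rparr>"

lemma mat_kernel_subspace:
  fixes A :: "'a::field mat"
  assumes A: "A \<in> carrier_mat m n"
  shows "VectorSpace.subspace class_ring (mat_kernel A) (module_vec TYPE('a) n)"
proof -
  interpret vec_space "TYPE('a)" n .
  show ?thesis
    unfolding VectorSpace.subspace_def
    apply (intro conjI vec_vs)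
    apply unfold_locales
    by (insert A mult_add_distrib_mat_vec[OF A] mult_mat_vec[OF A] mat_kernel[OF A], auto simp: class_ring_simps)
qed

text \<open>
  Independent sets in the subspace stay independent in the ambient space and so have at most \<open>n\<close>
  elements; a maximal one is a basis.
\<close>

lemma subspace_fin_dim:
  fixes U :: "'a::field vec set"
  assumes "VectorSpace.subspace class_ring U (module_vec TYPE('a) n)"
  shows "vectorspace.fin_dim class_ring (vsub TYPE('a) n U)"
proof -
  interpret vec_space "TYPE('a)" n .
  interpret U: vectorspace class_ring "vs U" using assms by (rule subspace_is_vs)
  have sub: "U \<subseteq> carrier_vec n" using assms by (auto simp: VectorSpace.subspace_def submodule_def)
  have li: "finite B \<and> card B \<le> n" if "B \<subseteq> U" "U.lin_indpt B" for B
  proof -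
    have "lin_indpt B"
      using that assms span_li_not_depend(2)[of B U] by (auto simp: VectorSpace.subspace_def)
    then show ?thesis using li_le_dim[of B] that sub dim_is_n by auto
  qed
  have "U.lin_indpt {}" using U.finite_lin_indpt2[of "{}"] by auto
  then have "\<exists>B. finite B \<and> maximal B (\<lambda>S. S \<subseteq> U \<and> U.lin_indpt S)"
    by (intro maximal_exists[of _ n "{}"]) (use li in auto)
  then obtain B where "finite B" "maximal B (\<lambda>S. S \<subseteq> carrier (vs U) \<and> U.lin_indpt S)" by auto
  then have "U.basis B" by (intro U.max_li_is_basis)
  then show ?thesis using \<open>finite B\<close> unfolding U.fin_dim_def U.basis_def by blast
qed

text \<open>
  Rank-nullity for the restriction of \<open>Y\<close> to the kernel of \<open>Z Y\<close>: its kernel is that of \<open>Y\<close>, since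
  \<open>ker Y\<close> lies in \<open>ker (Z Y)\<close>.
\<close>

lemma kernel_dim_mult:
  fixes Y Z :: "'a::field mat"
  assumes Y: "Y \<in> carrier_mat n n" and Z: "Z \<in> carrier_mat n n"
  shows "kernel_dim (Z * Y) = kernel_dim Y
     + vectorspace.dim class_ring (vsub TYPE('a) n ((*\<^sub>v) Y ` mat_kernel (Z * Y)))"
    and "VectorSpace.subspace class_ring ((*\<^sub>v) Y ` mat_kernel (Z * Y)) (module_vec TYPE('a) n)"
proof -
  have ZY: "Z * Y \<in> carrier_mat n n" using Y Z by auto
  interpret K: kernel n n "Z * Y" by unfold_locales (rule ZY)
  interpret KY: kernel n n Y by unfold_locales (rule Y)
  interpret T: linear_map class_ring "vsub TYPE('a) n (mat_kernel (Z * Y))" "module_vec TYPE('a) n" "(*\<^sub>v) Y"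
    apply unfold_locales
    using mult_add_distrib_mat_vec[OF Y] mult_mat_vec[OF Y] mat_kernel[OF ZY] Y
    by (auto simp: module_hom_def class_ring_simps module_vec_simps)
  have "mat_kernel Y \<subseteq> mat_kernel (Z * Y)" by (rule mat_kernel_mult_subset[OF Y Z])
  then have ker: "T.ker = mat_kernel Y"
    using mat_kernel[OF Y] mat_kernel[OF ZY] unfolding T.ker_def by (auto simp: module_vec_simps)
  have im: "T.im = (*\<^sub>v) Y ` mat_kernel (Z * Y)" unfolding T.im_def by simp
  show "kernel_dim (Z * Y) = kernel_dim Y
     + vectorspace.dim class_ring (vsub TYPE('a) n ((*\<^sub>v) Y ` mat_kernel (Z * Y)))"
    using T.rank_nullity[OF subspace_fin_dim[OF mat_kernel_subspace[OF ZY]]]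
    unfolding ker im by simp
  show "VectorSpace.subspace class_ring ((*\<^sub>v) Y ` mat_kernel (Z * Y)) (module_vec TYPE('a) n)"
    using T.imT_is_subspace unfolding im .
qed

lemma vsub_dim_mono:
  fixes U :: "'a::field vec set"
  assumes U: "VectorSpace.subspace class_ring U (module_vec TYPE('a) n)"
    and W: "VectorSpace.subspace class_ring W (module_vec TYPE('a) n)" and UW: "U \<subseteq> W"
  shows "vectorspace.dim class_ring (vsub TYPE('a) n U) \<le> vectorspace.dim class_ring (vsub TYPE('a) n W)"
proof -
  interpret vec_space "TYPE('a)" n .
  interpret W: vectorspace class_ring "vs W" using W by (rule subspace_is_vs)
  have "VectorSpace.subspace class_ring U (vs W)" by (rule nested_subspaces[OF W U UW])
  moreover have "(vs W)\<lparr>carrier := U\<rparr> = vs U" by simp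
  ultimately show ?thesis
    using W.subspace_dim[of U] subspace_fin_dim[OF W] subspace_fin_dim[OF U] by presburger
qed

text \<open>
  The Frobenius rank inequality in terms of kernels. By rank-nullity both differences
  \<open>dim ker (Z B C) - dim ker (B C)\<close> and \<open>dim ker (Z B) - dim ker B\<close> are dimensions of images, namely of
  \<open>ker Z \<inter> im (B C)\<close> and \<open>ker Z \<inter> im B\<close>, and the first is contained in the second.
\<close>

lemma kernel_dim_frobenius:
  fixes B :: "'a::field mat"
  assumes Z: "Z \<in> carrier_mat n n" and B: "B \<in> carrier_mat n n" and C: "C \<in> carrier_mat n n"
  shows "kernel_dim (Z * B * C) + kernel_dim B \<le> kernel_dim (B * C) + kernel_dim (Z * B)"
proof -
  have BC: "B * C \<in> carrier_mat n n" and ZB: "Z * B \<in> carrier_mat n n" using Z B C by auto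
  have ZBC: "Z * B * C = Z * (B * C)" by (rule assoc_mult_mat[OF Z B C])
  have "(*\<^sub>v) (B * C) ` mat_kernel (Z * (B * C)) \<subseteq> (*\<^sub>v) B ` mat_kernel (Z * B)"
  proof
    fix y assume "y \<in> (*\<^sub>v) (B * C) ` mat_kernel (Z * (B * C))"
    then obtain x where x: "x \<in> carrier_vec n" "Z * B * C *\<^sub>v x = 0\<^sub>v n" and y: "y = B * C *\<^sub>v x"
      using mat_kernelD[of "Z * (B * C)" n n] Z BC unfolding ZBC by auto
    have "C *\<^sub>v x \<in> mat_kernel (Z * B)"
      using x C ZB assoc_mult_mat_vec[OF ZB C x(1)] by (intro mat_kernelI[OF ZB]) auto
    moreover have "y = B *\<^sub>v (C *\<^sub>v x)" unfolding y by (rule assoc_mult_mat_vec[OF B C x(1)])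
    ultimately show "y \<in> (*\<^sub>v) B ` mat_kernel (Z * B)" by blast
  qed
  from vsub_dim_mono[OF kernel_dim_mult(2)[OF BC Z] kernel_dim_mult(2)[OF B Z] this]
  show ?thesis unfolding ZBC kernel_dim_mult(1)[OF BC Z] kernel_dim_mult(1)[OF B Z] by simp
qed

text \<open>
  The Bezout identity makes \<open>Q\<close> map the kernel of \<open>P Q\<close> onto the kernel of \<open>P\<close>: a vector \<open>y\<close>
  with \<open>P y = 0\<close> equals \<open>Q (V y)\<close>.
\<close>

lemma kernel_dim_coprime:
  fixes P :: "'a::field mat"
  assumes P: "P \<in> carrier_mat n n" and Q: "Q \<in> carrier_mat n n"
    and U: "U \<in> carrier_mat n n" and V: "V \<in> carrier_mat n n"
    and UV: "U * P + Q * V = 1\<^sub>m n" and PQV: "P * Q * V = V * Q * P"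
  shows "kernel_dim (P * Q) = kernel_dim P + kernel_dim Q"
proof -
  have PQ: "P * Q \<in> carrier_mat n n" using P Q by auto
  have z0: "W *\<^sub>v 0\<^sub>v n = 0\<^sub>v n" if "W \<in> carrier_mat n n" for W :: "'a mat" using that by auto
  have "(*\<^sub>v) Q ` mat_kernel (P * Q) = mat_kernel P"
  proof (intro equalityI subsetI)
    fix y assume "y \<in> (*\<^sub>v) Q ` mat_kernel (P * Q)"
    then show "y \<in> mat_kernel P" using mat_kernelD[OF PQ] P Q
      by (auto intro!: mat_kernelI[OF P] simp: assoc_mult_mat_vec[OF P Q])
  next
    fix y assume "y \<in> mat_kernel P"
    then have y: "y \<in> carrier_vec n" "P *\<^sub>v y = 0\<^sub>v n" using mat_kernelD[OF P] by auto
    have Vy: "V *\<^sub>v y \<in> carrier_vec n" using V y by auto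
    have "y = (U * P + Q * V) *\<^sub>v y" unfolding UV using y by simp
    also have "\<dots> = U * P *\<^sub>v y + Q * V *\<^sub>v y"
      using U P Q V y by (intro add_mult_distrib_mat_vec) auto
    also have "U * P *\<^sub>v y = 0\<^sub>v n" unfolding assoc_mult_mat_vec[OF U P y(1)] y(2) by (rule z0[OF U])
    also have "Q * V *\<^sub>v y = Q *\<^sub>v (V *\<^sub>v y)" by (rule assoc_mult_mat_vec[OF Q V y(1)])
    also have "0\<^sub>v n + Q *\<^sub>v (V *\<^sub>v y) = Q *\<^sub>v (V *\<^sub>v y)" using Q Vy by auto
    finally have 1: "y = Q *\<^sub>v (V *\<^sub>v y)" .
    have "P * Q *\<^sub>v (V *\<^sub>v y) = P * Q * V *\<^sub>v y" by (rule assoc_mult_mat_vec[OF PQ V y(1), symmetric])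
    also have "\<dots> = V * Q *\<^sub>v (P *\<^sub>v y)" unfolding PQV using V Q P y
      by (intro assoc_mult_mat_vec) auto
    also have "\<dots> = 0\<^sub>v n" unfolding y(2) by (rule z0[OF mult_carrier_mat[OF V Q]])
    finally have "V *\<^sub>v y \<in> mat_kernel (P * Q)" using Vy by (intro mat_kernelI[OF PQ])
    with 1 show "y \<in> (*\<^sub>v) Q ` mat_kernel (P * Q)" by blast
  qed
  moreover
  interpret kernel n n P by unfold_locales (rule P)
  show ?thesis unfolding kernel_dim_mult(1)[OF Q P] calculation by simp
qed

lemma kernel_dim_0: "kernel_dim (0\<^sub>m n n :: 'a::field mat) = n"
proof -
  interpret kernel n n "0\<^sub>m n n :: 'a mat" by unfold_locales auto
  have "mat_kernel (0\<^sub>m n n :: 'a mat) = carrier_vec n" by (auto simp: mat_kernel_def)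
  then have "VK = NC.V" by (simp add: module_vec_def)
  then show ?thesis using NC.dim_is_n by simp
qed

lemma kernel_dim_full_imp_0:
  fixes A :: "'a::field mat"
  assumes A: "A \<in> carrier_mat n n" and full: "kernel_dim A = n"
  shows "A = 0\<^sub>m n n"
proof -
  interpret kernel n n A by unfold_locales (rule A)
  obtain B where B: "finite B" "basis B" using kernel_basis_exists[OF A] by auto
  then have sub: "B \<subseteq> mat_kernel A" and li: "lin_indpt B" by (auto simp: Ker.basis_def)
  have c: "B \<subseteq> carrier_vec n" using sub mat_kernel_carrier[OF A] by auto
  have "card B = n" using Ker.dim_basis[OF B] full by simp
  then have "NC.basis B"
    using NC.dim_li_is_basis[of B] li lindep_same[OF sub] c B(1) NC.dim_is_n by simp
  then have "carrier_vec n = NC.span B" by (auto simp: NC.basis_def)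
  also have "\<dots> = span B" using span_same[OF sub] by simp
  also have "\<dots> \<subseteq> mat_kernel A" using Ker.span_closed[OF sub] by auto
  finally have all: "x \<in> carrier_vec n \<Longrightarrow> A *\<^sub>v x = 0\<^sub>v n" for x using mat_kernelD[OF A] by auto
  show ?thesis
  proof (rule eq_matI)
    fix i j assume ij: "i < dim_row (0\<^sub>m n n :: 'a mat)" "j < dim_col (0\<^sub>m n n :: 'a mat)"
    then have "A $$ (i,j) = (A *\<^sub>v unit_vec n j) $ i" using A by simp
    also have "\<dots> = 0" using ij by (subst all) auto
    finally show "A $$ (i,j) = 0\<^sub>m n n $$ (i,j)" using ij by simp
  qed (use A in auto)
qed

lemma kernel_dim_le_1:
  fixes A :: "'a::field mat"
  assumes A: "A \<in> carrier_mat n n" and w: "w \<in> carrier_vec n"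
    and *: "\<And>x. x \<in> mat_kernel A \<Longrightarrow> \<exists>c. x = c \<cdot>\<^sub>v w"
  shows "kernel_dim A \<le> 1"
proof -
  interpret kernel n n A by unfold_locales (rule A)
  show ?thesis
  proof (cases "\<exists>x\<in>mat_kernel A. x \<noteq> 0\<^sub>v n")
    case True
    then obtain x where x: "x \<in> mat_kernel A" "x \<noteq> 0\<^sub>v n" by auto
    then obtain c where c: "x = c \<cdot>\<^sub>v w" using * by auto
    have "c \<noteq> 0" using x w c by auto
    have xc: "x \<in> carrier_vec n" using w c by auto
    have "mat_kernel A \<subseteq> span {x}"
    proof
      fix y assume y: "y \<in> mat_kernel A"
      then obtain b where b: "y = b \<cdot>\<^sub>v w" using * by auto
      have "y = (b / c) \<cdot>\<^sub>v x" unfolding b c using w \<open>c \<noteq> 0\<close> by (simp add: smult_smult_assoc)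
      moreover have "(b / c) \<cdot>\<^sub>v x \<in> NC.span {x}" using NC.smult_in_span[of "{x}" x "b/c"] xc
        by (simp add: NC.span_self)
      ultimately show "y \<in> span {x}" using span_same[of "{x}"] x by auto
    qed
    then have "Ker.gen_set {x}" using Ker.span_closed[of "{x}"] x by auto
    then show ?thesis using Ker.dim_le1I[of x] x by simp
  next
    case False
    moreover have z: "0\<^sub>v n \<in> mat_kernel A" using A by (intro mat_kernelI[OF A]) auto
    ultimately have k: "mat_kernel A = {0\<^sub>v n}" by blast
    have "mat_kernel A \<subseteq> span {0\<^sub>v n}" using Ker.span_self[OF z] k by (metis empty_subsetI insert_subset)
    then have "Ker.gen_set {0\<^sub>v n}" using Ker.span_closed[of "{0\<^sub>v n}"] z by auto
    then show ?thesis using Ker.dim0I by simp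
  qed
qed

section \<open>Nullities of polynomials in a matrix\<close>

definition nullity :: "'a::field mat \<Rightarrow> 'a poly \<Rightarrow> nat" where
  "nullity A p = kernel_dim (poly_mat A p)"

lemma nullity_0: "A \<in> carrier_mat n n \<Longrightarrow> nullity A 0 = n"
  by (simp add: nullity_def poly_mat_0 kernel_dim_0)

lemma dim_gen_eigenspace_eq_nullity:
  "A \<in> carrier_mat n n \<Longrightarrow> dim_gen_eigenspace A e k = nullity A ([:- e, 1:] ^ k)"
  by (simp add: dim_gen_eigenspace_def nullity_def poly_mat_power poly_mat_char_matrix)

lemma nullity_coprime:
  assumes A: "A \<in> carrier_mat n n" and uv: "u * p + v * q = 1"
  shows "nullity A (p * q) = nullity A p + nullity A q"
  unfolding nullity_def poly_mat_mult[OF A]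
proof (rule kernel_dim_coprime[of _ n _ "poly_mat A u" "poly_mat A v"])
  show "poly_mat A u * poly_mat A p + poly_mat A q * poly_mat A v = 1\<^sub>m n"
    using uv A by (simp flip: poly_mat_mult[OF A] poly_mat_add[OF A] add: mult.commute)
  show "poly_mat A p * poly_mat A q * poly_mat A v = poly_mat A v * poly_mat A q * poly_mat A p"
    by (simp flip: poly_mat_mult[OF A] add: mult_ac)
qed (use A in auto)

text \<open>
  For \<open>p = X - \<mu>\<close> and \<open>q\<close> a power of \<open>p\<close> this is the concavity of \<open>k \<mapsto> dim ker (A - \<mu>)\<^sup>k\<close>.
\<close>

lemma nullity_frobenius:
  assumes A: "A \<in> carrier_mat n n"
  shows "nullity A (p * q * r) + nullity A q \<le> nullity A (q * r) + nullity A (p * q)"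
  unfolding nullity_def poly_mat_mult[OF A] by (rule kernel_dim_frobenius) (use A in auto)

lemma nullity_mono:
  assumes A: "A \<in> carrier_mat n n"
  shows "nullity A p \<le> nullity A (q * p)"
  using kernel_dim_mult(1)[of "poly_mat A p" n "poly_mat A q"] A
  by (simp add: nullity_def poly_mat_mult[OF A])

lemma nullity_full_imp_0:
  assumes A: "A \<in> carrier_mat n n" and "nullity A p = n"
  shows "poly_mat A p = 0\<^sub>m n n"
  using assms by (intro kernel_dim_full_imp_0) (auto simp: nullity_def)

lemma nullity_smult_unit:
  assumes A: "A \<in> carrier_mat n n" and c: "c \<noteq> 0"
  shows "nullity A (smult c p) = nullity A p"
  using nullity_mono[OF A, of p "[:c:]"] nullity_mono[OF A, of "smult c p" "[:inverse c:]"] c by simp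

lemma nullity_similar:
  assumes A: "A \<in> carrier_mat n n" and s: "similar_mat A B"
  shows "nullity A p = nullity B p"
proof -
  from s obtain P Q where w: "similar_mat_wit A B P Q" by (auto simp: similar_mat_def)
  note w' = similar_mat_witD2[OF A w]
  have B: "B \<in> carrier_mat n n" and P: "P \<in> carrier_mat n n" and Q: "Q \<in> carrier_mat n n"
    using w' by auto
  have "A * P = P * B * (Q * P)" using w' by (simp add: assoc_mult_mat[of _ n n _ n _ n])
  then have AP: "A * P = P * B" using w' by simp
  have pB: "poly_mat B p \<in> carrier_mat n n" and pA: "poly_mat A p \<in> carrier_mat n n" using A B by auto
  have "P * poly_mat B p * Q = poly_mat A p * (P * Q)"
    by (simp only: poly_mat_intertwine[OF A B P AP, symmetric] assoc_mult_mat[OF pA P Q])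
  then have pAB: "poly_mat A p = P * poly_mat B p * Q" using w' right_mult_one_mat[OF pA] by presburger
  then have "similar_mat_wit (poly_mat A p) (poly_mat B p) P Q"
    by (intro similar_mat_witI[OF w'(1,2) pAB pA pB P Q])
  from similar_mat_wit_kernel_dim[OF pA this] show ?thesis
    using pA pB by (simp add: nullity_def kernel_dim_def)
qed

lemma nullity_four_block:
  assumes A: "A \<in> carrier_mat n n" and B: "B \<in> carrier_mat m m"
  shows "nullity (four_block_mat A (0\<^sub>m n m) (0\<^sub>m m n) B) p = nullity A p + nullity B p"
proof -
  have c: "poly_mat A p \<in> carrier_mat n n" "poly_mat B p \<in> carrier_mat m m" using A B by auto
  show ?thesis
    unfolding nullity_def poly_mat_four_block[OF A B] 
    using kernel_four_block_0_mat[OF refl c] c by (simp add: kernel_dim_def)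
qed

text \<open>
  The ideal generated by \<open>p\<close> and \<open>q\<close> consists of the multiples of a nonzero element of least degree,
  which divides both and hence has no irreducible factor.
\<close>

lemma field_poly_bezout:
  fixes p q :: "'a::field poly"
  assumes p: "p \<noteq> 0" and irr: "\<And>s. irreducible s \<Longrightarrow> s dvd p \<Longrightarrow> s dvd q \<Longrightarrow> False"
  shows "\<exists>u v. u * p + v * q = 1"
proof -
  define I where "I = {u * p + v * q |u v. True}"
  have pI: "p \<in> I" "q \<in> I" unfolding I_def
    by (metis (mono_tags, lifting) mem_Collect_eq mult_zero_left mult_1 add_0 add_0_right)+
  obtain g where g: "g \<in> I" "g \<noteq> 0" and min: "\<And>h. h \<in> I \<Longrightarrow> h \<noteq> 0 \<Longrightarrow> degree g \<le> degree h"
    using ex_has_least_nat[of "\<lambda>h. h \<in> I \<and> h \<noteq> 0" p degree] p pI by blast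
  obtain u v where uv: "g = u * p + v * q" using g by (auto simp: I_def)
  have dvd: "g dvd h" if h: "h \<in> I" for h
  proof (rule ccontr)
    assume nd: "\<not> g dvd h"
    obtain a b where ab: "h = a * p + b * q" using h by (auto simp: I_def)
    have "h mod g = h - h div g * g" by (simp add: minus_div_mult_eq_mod)
    also have "\<dots> = (a - h div g * u) * p + (b - h div g * v) * q"
      unfolding uv ab by (simp add: algebra_simps)
    finally have "h mod g \<in> I" by (auto simp: I_def)
    moreover have "h mod g \<noteq> 0" using nd by (simp add: dvd_eq_mod_eq_0)
    ultimately show False using min[of "h mod g"] degree_mod_less[of g h] g by auto
  qed
  have "degree g = 0"
  proof (rule ccontr)
    assume "degree g \<noteq> 0"
    then obtain s t where "irreducible s" "g = s * t" using irreducible\<^sub>d_factor[of g] by auto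
    then show False using irr[of s] dvd[OF pI(1)] dvd[OF pI(2)] by (meson dvd_mult_left dvd_trans dvd_triv_left)
  qed
  then obtain c where c: "g = [:c:]" by (auto elim: degree_eq_zeroE)
  with g have "c \<noteq> 0" by auto
  then have "smult (inverse c) u * p + smult (inverse c) v * q = 1"
    using uv[symmetric] unfolding c by (simp flip: smult_add_right add: one_pCons)
  then show ?thesis by blast
qed

lemma bezout_linear_power:
  fixes q :: "'a::field poly"
  assumes "poly q a \<noteq> 0"
  shows "\<exists>u v. u * [:- a, 1:] ^ k + v * q = 1"
proof (rule field_poly_bezout)
  fix s :: "'a poly" assume s: "irreducible s" "s dvd [:- a, 1:] ^ k" "s dvd q"
  then have "s dvd [:- a, 1:]" 
    using prime_elem_dvd_power[OF field_poly_irreducible_imp_prime] by blast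
  then have "[:- a, 1:] dvd s"
    using s(1) irreducible_linear_field_poly[of 1 "-a"]
    by (metis irreducibleD' irreducible_not_unit one_neq_zero)
  with s have "[:- a, 1:] dvd q" by (meson dvd_trans)
  with assms show False by (simp add: poly_eq_0_iff_dvd)
qed auto

section \<open>Completion to a basis and Jordan forms over algebraically closed fields\<close>

lemma det_nonzero_obtain_inverse:
  fixes P :: "'a::field mat"
  assumes P: "P \<in> carrier_mat n n" and "det P \<noteq> 0"
  obtains Q where "Q \<in> carrier_mat n n" "P * Q = 1\<^sub>m n" "Q * P = 1\<^sub>m n"
  using det_non_zero_imp_unit[OF assms, of "()"] unfolding Units_def ring_mat_def by auto

text \<open>
  The columns of an injective matrix are linearly independent, so by Steinitz exchange with the unit
  vectors they extend to a basis. The conclusion \<open>d \<le> n\<close> also serves as the statement that more than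
  \<open>n\<close> vectors are dependent.
\<close>

lemma extend_to_invertible:
  fixes C :: "'a::field mat"
  assumes C: "C \<in> carrier_mat n d"
    and inj: "\<And>x. x \<in> carrier_vec d \<Longrightarrow> C *\<^sub>v x = 0\<^sub>v n \<Longrightarrow> x = 0\<^sub>v d"
  obtains P Q where "P \<in> carrier_mat n n" "Q \<in> carrier_mat n n" "P * Q = 1\<^sub>m n" "Q * P = 1\<^sub>m n"
    "d \<le> n" "\<And>j. j < d \<Longrightarrow> col P j = col C j"
proof -
  interpret vec_space "TYPE('a)" n .
  let ?S = "set (cols C)"
  have dist: "distinct (cols C)"
    unfolding distinct_conv_nth
  proof (intro allI impI notI)
    fix i j assume ij: "i < length (cols C)" "j < length (cols C)" "i \<noteq> j" "cols C ! i = cols C ! j"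
    then have ij': "i < d" "j < d" "col C i = col C j" using C by auto
    let ?x = "unit_vec d i - unit_vec d j :: 'a vec"
    have "C *\<^sub>v ?x = C *\<^sub>v unit_vec d i - C *\<^sub>v unit_vec d j"
      by (rule mult_minus_distrib_mat_vec[OF C]) auto
    also have "\<dots> = col C i - col C j" using C ij'(1,2) by (intro eq_vecI) auto
    also have "\<dots> = 0\<^sub>v n" using ij' C by auto
    finally have "?x = 0\<^sub>v d" by (intro inj) auto
    then have "?x $ i = 0" using ij' by simp
    then show False using ij' ij(3) by simp
  qed
  have indpt: "lin_indpt ?S" using lin_depE[OF C _ dist] inj by metis
  have sub: "?S \<subseteq> carrier_vec n" using C cols_dim by blast
  have card: "card ?S = d" using dist C by (simp add: distinct_card)
  have cu: "card (set (unit_vecs n :: 'a vec list)) = n"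
    using distinct_card[OF unit_vecs_distinct] by simp
  have us: "span (set (unit_vecs n)) = carrier_vec n" by (rule span_unit_vecs_is_carrier)
  obtain T where T: "finite T" "T \<subseteq> carrier_vec n" "T \<inter> ?S = {}"
      "int (card T) \<le> int n - int d" "span (?S \<union> T) = carrier_vec n"
    using replacement[of ?S "set (unit_vecs n)"] indpt sub unfolding us cu card
    by (auto simp: unit_vecs_carrier)
  have cardT: "card (?S \<union> T) = d + card T"
    using card_Un_disjoint[of ?S T] card T(1,3) by auto
  then have le: "card (?S \<union> T) \<le> n" "card (?S \<union> T) = d + card T"
    using T(4) by linarith+
  have "basis (?S \<union> T)"
    using T sub le dim_is_n by (intro dim_gen_is_basis) auto
  then have indpt': "lin_indpt (?S \<union> T)" and c: "card (?S \<union> T) = n"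
    using dim_basis[of "?S \<union> T"] T(1) dim_is_n by (auto simp: basis_def)
  obtain ts where ts: "set ts = T" "distinct ts" using finite_distinct_list[OF T(1)] by auto
  define P where "P = mat_of_cols n (cols C @ ts)"
  have len: "length (cols C @ ts) = n" using c le distinct_card[OF ts(2)] ts(1) C by simp
  have P: "P \<in> carrier_mat n n" using mat_of_cols_carrier(1)[of n "cols C @ ts"] len unfolding P_def by simp
  have cP: "cols P = cols C @ ts" unfolding P_def using sub T(2) ts by (intro cols_mat_of_cols) auto
  have "rank P = n"
    by (rule lin_indpt_full_rank[OF P]) (use dist ts T(3) indpt' in \<open>auto simp: cP\<close>)
  then have "det P \<noteq> 0" using det_rank_iff[OF P] by simp
  from det_nonzero_obtain_inverse[OF P this] obtain Q where
    Q: "Q \<in> carrier_mat n n" "P * Q = 1\<^sub>m n" "Q * P = 1\<^sub>m n" .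
  have "d \<le> n" using le c by simp
  moreover have "col P j = col C j" if "j < d" for j
  proof -
    have "col P j = cols P ! j" using that \<open>d \<le> n\<close> P by simp
    also have "\<dots> = col C j" unfolding cP using that C by (simp add: nth_append)
    finally show ?thesis .
  qed
  ultimately show thesis using that P Q by blast
qed

text \<open>
  Schur triangularization without an inner product: an eigenvector is completed to some basis, and
  the lower right block is treated by induction.
\<close>

lemma similar_upper_triangular:
  fixes A :: "'a::alg_closed_field mat"
  assumes "A \<in> carrier_mat n n"
  shows "\<exists>B. similar_mat A B \<and> upper_triangular B"
  using assms
proof (induct n arbitrary: A)
  case 0
  then show ?case using similar_mat_refl[of A 0] by (intro exI[of _ A]) auto
next
  case (Suc m)
  let ?n = "Suc m"
  note A = Suc(2)
  obtain e where "poly (char_poly A) e = 0"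
    using alg_closed_imp_poly_has_root[of "char_poly A"] degree_monic_char_poly[OF A] by auto
  then have "eigenvalue A e" using eigenvalue_root_char_poly[OF A] by simp
  then obtain v where v: "v \<in> carrier_vec ?n" "v \<noteq> 0\<^sub>v ?n" and Av: "A *\<^sub>v v = e \<cdot>\<^sub>v v"
    using A by (auto simp: eigenvalue_def eigenvector_def)
  define C where "C = mat_of_cols ?n [v]"
  have C: "C \<in> carrier_mat ?n 1" by (auto simp: C_def)
  have cC: "col C 0 = v" using v by (auto simp: C_def)
  have Cx: "C *\<^sub>v x = x $ 0 \<cdot>\<^sub>v v" if "x \<in> carrier_vec 1" for x
    using that v by (intro eq_vecI) (auto simp: C_def scalar_prod_def mat_of_cols_def)
  have "x = 0\<^sub>v 1" if "x \<in> carrier_vec 1" "C *\<^sub>v x = 0\<^sub>v ?n" for x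
  proof -
    have "x $ 0 = 0"
    proof (rule ccontr)
      assume x: "x $ 0 \<noteq> 0"
      have "v = inverse (x $ 0) \<cdot>\<^sub>v (x $ 0 \<cdot>\<^sub>v v)" using x by (simp add: smult_smult_assoc)
      also have "\<dots> = 0\<^sub>v ?n" unfolding Cx[OF that(1), symmetric] that(2) by (intro eq_vecI) auto
      finally show False using v by simp
    qed
    then show ?thesis using that(1) by (intro eq_vecI) auto
  qed
  from extend_to_invertible[OF C this] obtain P Q where P: "P \<in> carrier_mat ?n ?n" and Q: "Q \<in> carrier_mat ?n ?n"
    and PQ: "P * Q = 1\<^sub>m ?n" "Q * P = 1\<^sub>m ?n" and "\<And>j. j < 1 \<Longrightarrow> col P j = col C j" by metis
  then have cP: "col P 0 = v" using cC by simp
  define B where "B = Q * A * P"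
  have B: "B \<in> carrier_mat ?n ?n" using P Q A by (auto simp: B_def)
  have "P * B * Q = (P * Q) * A * (P * Q)" unfolding B_def using P Q A 
    by (simp add: assoc_mult_mat[of _ ?n ?n _ ?n _ ?n])
  then have AB: "similar_mat A B" using PQ A B P Q by (intro similar_matI[of _ _ P Q ?n]) auto
  have "col B 0 = (Q * A) *\<^sub>v v"
    unfolding B_def cP[symmetric] by (rule col_mult2[OF mult_carrier_mat[OF Q A] P]) simp
  also have "\<dots> = Q *\<^sub>v (A *\<^sub>v v)" by (rule assoc_mult_mat_vec[OF Q A v(1)])
  also have "\<dots> = e \<cdot>\<^sub>v (Q *\<^sub>v v)" unfolding Av by (rule mult_mat_vec[OF Q v(1)])
  also have "Q *\<^sub>v v = col (Q * P) 0" unfolding cP[symmetric] by (rule col_mult2[OF Q P, symmetric]) simp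
  also have "\<dots> = unit_vec ?n 0" unfolding PQ by simp
  finally have cB: "col B 0 = e \<cdot>\<^sub>v unit_vec ?n 0" .
  have B0: "B $$ (i, 0) = (if i = 0 then e else 0)" if "i < ?n" for i
    using arg_cong[OF cB, of "\<lambda>v. vec_index v i"] that B by auto
  define D where "D = mat m m (\<lambda>(i, j). B $$ (Suc i, Suc j))"
  have D: "D \<in> carrier_mat m m" by (simp add: D_def)
  from Suc(1)[OF D] obtain E where DE: "similar_mat D E" and E: "upper_triangular E" by auto
  from similar_matD[OF DE] D obtain U V where UV: "{D, E, U, V} \<subseteq> carrier_mat m m" "U * V = 1\<^sub>m m"
    "V * U = 1\<^sub>m m" "D = U * E * V" by (metis carrier_matD(1) insert_subset)
  then have c: "E \<in> carrier_mat m m" "U \<in> carrier_mat m m" "V \<in> carrier_mat m m" by auto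
  define R where "R = mat 1 m (\<lambda>(i, j). B $$ (0, Suc j))"
  have R: "R \<in> carrier_mat 1 m" by (simp add: R_def)
  define I1 where "I1 = (1\<^sub>m 1 :: 'a mat)"
  have I1: "I1 \<in> carrier_mat 1 1" by (simp add: I1_def)
  define e1 where "e1 = mat 1 1 (\<lambda>_. e)"
  have e1: "e1 \<in> carrier_mat 1 1" by (simp add: e1_def)
  have B_eq: "B = four_block_mat e1 R (0\<^sub>m m 1) D"
    using B B0 by (intro eq_matI) (auto simp: e1_def R_def D_def less_Suc_eq_0_disj)
  define F where "F = four_block_mat e1 (R * U) (0\<^sub>m m 1) E"
  define U' where "U' = four_block_mat I1 (0\<^sub>m 1 m) (0\<^sub>m m 1) U"
  define V' where "V' = four_block_mat I1 (0\<^sub>m 1 m) (0\<^sub>m m 1) V"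
  have UU: "U' \<in> carrier_mat ?n ?n" "V' \<in> carrier_mat ?n ?n" "F \<in> carrier_mat ?n ?n"
    using c I1 e1 by (auto simp: U'_def V'_def F_def)
  have "U' * V' = four_block_mat (1\<^sub>m 1) (0\<^sub>m 1 m) (0\<^sub>m m 1) (1\<^sub>m m)"
    unfolding U'_def V'_def using c I1 UV
    by (subst mult_four_block_mat[of _ 1 1 _ m _ m _ _ 1 _ m]) (auto simp: I1_def)
  moreover have "V' * U' = four_block_mat (1\<^sub>m 1) (0\<^sub>m 1 m) (0\<^sub>m m 1) (1\<^sub>m m)"
    unfolding U'_def V'_def using c I1 UV
    by (subst mult_four_block_mat[of _ 1 1 _ m _ m _ _ 1 _ m]) (auto simp: I1_def)
  ultimately have UV': "U' * V' = 1\<^sub>m ?n" "V' * U' = 1\<^sub>m ?n" by simp_all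
  have "U' * F = four_block_mat e1 (R * U) (0\<^sub>m m 1) (U * E)"
    unfolding U'_def F_def using c I1 e1 R
    by (subst mult_four_block_mat[of _ 1 1 _ m _ m _ _ 1 _ m]) (auto simp: I1_def)
  then have "U' * F * V' = four_block_mat e1 (R * U * V) (0\<^sub>m m 1) (U * E * V)"
    unfolding V'_def using c I1 e1 R
    by (simp, subst mult_four_block_mat[of _ 1 1 _ m _ m _ _ 1 _ m]) (auto simp: I1_def)
  also have "R * U * V = R" using R c UV(2) by simp
  finally have "B = U' * F * V'" unfolding B_eq UV(4) by simp
  then have BF: "similar_mat B F" using UU UV' B by (intro similar_matI[of _ _ U' V' ?n]) auto
  have "upper_triangular F"
    using c E R e1 by (auto simp: F_def upper_triangular_def)
  then show ?case using similar_mat_trans[OF AB BF] by blast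
qed

text \<open>
  The reduction of triangular matrices to Jordan form works over every field, so only the
  triangularization needs the algebraically closed field.
\<close>

lemma jordan_nf_exists_alg_closed:
  fixes A :: "'a::alg_closed_field mat"
  assumes A: "A \<in> carrier_mat n n"
  shows "\<exists>n_as. jordan_nf A n_as"
proof -
  obtain B where B: "similar_mat A B" "upper_triangular B" using similar_upper_triangular[OF A] by blast
  have "B \<in> carrier_mat n n" using similar_matD[OF B(1)] A by auto
  from triangular_to_jnf_vector[OF this B(2)] similar_mat_trans[OF B(1)] show ?thesis
    unfolding jordan_nf_def by blast
qed

section \<open>Composites and anticommuting square roots\<close>

lemma char_ne_2_imp_two_neq_0:
  assumes "CHAR('a::field) \<noteq> 2"
  shows "(2 :: 'a) \<noteq> 0"
proof
  assume "(2 :: 'a) = 0"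
  then have "of_nat 2 = (0 :: 'a)" by simp
  then have "CHAR('a) dvd 2" unfolding of_nat_eq_0_iff_char_dvd .
  then have "CHAR('a) = 1 \<or> CHAR('a) = 2" using prime_nat_iff two_is_prime_nat by blast
  with assms show False by (simp add: CHAR_eqI)
qed

lemma poly_mat_square_diff:
  assumes A: "A \<in> carrier_mat n n"
  shows "poly_mat A [:a\<^sup>2, 0, -1:] = a\<^sup>2 \<cdot>\<^sub>m 1\<^sub>m n + - (A * A)"
proof -
  have "[:a\<^sup>2, 0, -1:] = [:a\<^sup>2:] + - ([:0, 1:] * [:0, 1:])" by simp
  then show ?thesis
    by (simp only: poly_mat_add[OF A] poly_mat_uminus[OF A] poly_mat_mult[OF A] poly_mat_X[OF A] poly_mat_const[OF A])
qed

text \<open>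
  The witness is \<open>S = a (p + q - 1)\<close>, and the claims are identities in the span of
  \<open>p, q, 1, p q, q p\<close>.
\<close>

lemma composite_imp_anticommuting:
  fixes A :: "'a::field mat"
  assumes A: "A \<in> carrier_mat n n" and "mat_composite n a (- a) A"
  shows "\<exists>S\<in>carrier_mat n n. S * A = - (A * S) \<and> S * S = poly_mat A [:a\<^sup>2, 0, -1:]"
proof -
  from assms obtain p q where p: "p \<in> carrier_mat n n" "p * p = p"
    and q: "q \<in> carrier_mat n n" "q * q = q" and A_eq: "A = a \<cdot>\<^sub>m p + (- a) \<cdot>\<^sub>m q"
    unfolding mat_composite_def mat_idempotent_def by blast
  let ?I = "1\<^sub>m n :: 'a mat"
  have pq: "p * q \<in> carrier_mat n n" "q * p \<in> carrier_mat n n" using p q by auto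
  \<comment> \<open>With \<open>A\<close> and \<open>S\<close> both in the span of \<open>p\<close>, \<open>q\<close>,
      \<open>1\<close>, one product formula covers all three products.\<close>
  define S where "S = a \<cdot>\<^sub>m p + a \<cdot>\<^sub>m q + (- a) \<cdot>\<^sub>m ?I"
  have S: "S \<in> carrier_mat n n" using p q by (auto simp: S_def)
  have expand: "(x1 \<cdot>\<^sub>m p + y1 \<cdot>\<^sub>m q + z1 \<cdot>\<^sub>m ?I) * (x2 \<cdot>\<^sub>m p + y2 \<cdot>\<^sub>m q + z2 \<cdot>\<^sub>m ?I)
     = (x1 * x2 + x1 * z2 + z1 * x2) \<cdot>\<^sub>m p + (y1 * y2 + y1 * z2 + z1 * y2) \<cdot>\<^sub>m q + (z1 * z2) \<cdot>\<^sub>m ?I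
       + (x1 * y2) \<cdot>\<^sub>m (p * q) + (y1 * x2) \<cdot>\<^sub>m (q * p)" for x1 y1 z1 x2 y2 z2
  proof -
    let ?R = "x2 \<cdot>\<^sub>m p + y2 \<cdot>\<^sub>m q + z2 \<cdot>\<^sub>m ?I"
    have R: "?R \<in> carrier_mat n n" using p q by auto
    have l: "M * ?R = x2 \<cdot>\<^sub>m (M * p) + y2 \<cdot>\<^sub>m (M * q) + z2 \<cdot>\<^sub>m M" if "M \<in> carrier_mat n n" for M
      using that p q by (simp add: mult_add_distrib_mat[of _ n n _ n] mult_smult_distrib[of _ n n _ n])
    have "(x1 \<cdot>\<^sub>m p + y1 \<cdot>\<^sub>m q + z1 \<cdot>\<^sub>m ?I) * ?R = x1 \<cdot>\<^sub>m (p * ?R) + y1 \<cdot>\<^sub>m (q * ?R) + z1 \<cdot>\<^sub>m ?R"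
      using p q R by (simp add: add_mult_distrib_mat[of _ n n _ _ n] mult_smult_assoc_mat[of _ n n _ n])
    also have "\<dots> = x1 \<cdot>\<^sub>m (x2 \<cdot>\<^sub>m p + y2 \<cdot>\<^sub>m (p * q) + z2 \<cdot>\<^sub>m p)
        + y1 \<cdot>\<^sub>m (x2 \<cdot>\<^sub>m (q * p) + y2 \<cdot>\<^sub>m q + z2 \<cdot>\<^sub>m q) + z1 \<cdot>\<^sub>m ?R"
      unfolding l[OF p(1)] l[OF q(1)] p(2) q(2) ..
    also have "\<dots> = (x1 * x2 + x1 * z2 + z1 * x2) \<cdot>\<^sub>m p + (y1 * y2 + y1 * z2 + z1 * y2) \<cdot>\<^sub>m q + (z1 * z2) \<cdot>\<^sub>m ?I
       + (x1 * y2) \<cdot>\<^sub>m (p * q) + (y1 * x2) \<cdot>\<^sub>m (q * p)"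
      using p(1) q(1) by (intro eq_matI) (auto simp: algebra_simps simp del: index_mult_mat(1))
    finally show ?thesis .
  qed
  have A_eq': "A = a \<cdot>\<^sub>m p + (- a) \<cdot>\<^sub>m q + 0 \<cdot>\<^sub>m ?I" unfolding A_eq using p q by (intro eq_matI) auto
  have 1: "S * A = - (A * S)"
    unfolding S_def A_eq' expand using p(1) q(1) 
    by (intro eq_matI) (auto simp: algebra_simps simp del: index_mult_mat(1))
  have "poly_mat A [:a\<^sup>2, 0, -1:] = a\<^sup>2 \<cdot>\<^sub>m ?I + - (A * A)" by (rule poly_mat_square_diff[OF A])
  also have "\<dots> = S * S"
    unfolding S_def A_eq' expand using p(1) q(1) 
    by (intro eq_matI) (auto simp: algebra_simps power2_eq_square simp del: index_mult_mat(1))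
  finally show ?thesis using S 1 by metis
qed

text \<open>
  The idempotents are \<open>(a + A + S) / 2a\<close> and \<open>(a - A + S) / 2a\<close>: the square of \<open>a \<plusminus> A + S\<close> is \<open>2a\<close>
  times itself because \<open>A S\<close> and \<open>S A\<close> cancel and \<open>A\<^sup>2 + S\<^sup>2 = a\<^sup>2\<close>.
\<close>

lemma anticommuting_imp_composite:
  fixes A :: "'a::field mat"
  assumes A: "A \<in> carrier_mat n n" and S: "S \<in> carrier_mat n n"
    and anti: "S * A = - (A * S)" and sq: "S * S = poly_mat A [:a\<^sup>2, 0, -1:]"
    and a: "a \<noteq> 0" and two: "(2 :: 'a) \<noteq> 0"
  shows "mat_composite n a (- a) A"
proof -
  let ?I = "1\<^sub>m n :: 'a mat"
  have sq': "S * S = a\<^sup>2 \<cdot>\<^sub>m ?I + - (A * A)" unfolding sq by (rule poly_mat_square_diff[OF A])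
  define c where "c = inverse (2 * a)"
  have c: "2 * a * c = 1" using a two by (simp add: c_def)
  \<comment> \<open>Both signs \<open>e = \<plusminus>1\<close> occur: \<open>e = 1\<close> gives \<open>p\<close> and \<open>e =
      - 1\<close> gives \<open>q\<close>.\<close>
  have idem: "mat_idempotent n (c \<cdot>\<^sub>m (a \<cdot>\<^sub>m ?I + e \<cdot>\<^sub>m A + S))" if e: "e * e = 1" for e
  proof -
    let ?M = "a \<cdot>\<^sub>m ?I + e \<cdot>\<^sub>m A + S"
    have M: "?M \<in> carrier_mat n n" using A S by auto
    have l: "N * ?M = a \<cdot>\<^sub>m N + e \<cdot>\<^sub>m (N * A) + N * S" if "N \<in> carrier_mat n n" for N
      using that A S by (simp add: mult_add_distrib_mat[of _ n n _ n] mult_smult_distrib[of _ n n _ n])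
    have "?M * ?M = a \<cdot>\<^sub>m ?M + e \<cdot>\<^sub>m (A * ?M) + S * ?M"
      using A S M by (simp add: add_mult_distrib_mat[of _ n n _ _ n] mult_smult_assoc_mat[of _ n n _ n])
    also have "\<dots> = a \<cdot>\<^sub>m ?M + e \<cdot>\<^sub>m (a \<cdot>\<^sub>m A + e \<cdot>\<^sub>m (A * A) + A * S)
      + (a \<cdot>\<^sub>m S + e \<cdot>\<^sub>m (- (A * S)) + (a\<^sup>2 \<cdot>\<^sub>m ?I + - (A * A)))"
      unfolding l[OF A] l[OF S] anti sq' ..
    also have "\<dots> = (2 * a) \<cdot>\<^sub>m ?M"
    proof (rule eq_matI)
      fix i j assume ij: "i < dim_row ((2 * a) \<cdot>\<^sub>m ?M)" "j < dim_col ((2 * a) \<cdot>\<^sub>m ?M)"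
      have "e * (e * x) = x" for x using e by (simp flip: mult.assoc)
      then show "(a \<cdot>\<^sub>m ?M + e \<cdot>\<^sub>m (a \<cdot>\<^sub>m A + e \<cdot>\<^sub>m (A * A) + A * S)
        + (a \<cdot>\<^sub>m S + e \<cdot>\<^sub>m (- (A * S)) + (a\<^sup>2 \<cdot>\<^sub>m ?I + - (A * A)))) $$ (i, j) = ((2 * a) \<cdot>\<^sub>m ?M) $$ (i, j)"
        using A S ij by (auto simp: algebra_simps power2_eq_square simp del: index_mult_mat(1))
    qed (use A S in auto)
    finally have MM: "?M * ?M = (2 * a) \<cdot>\<^sub>m ?M" .
    have "(c \<cdot>\<^sub>m ?M) * (c \<cdot>\<^sub>m ?M) = (c * c) \<cdot>\<^sub>m (?M * ?M)"
      using M by (simp add: mult_smult_assoc_mat[of _ n n _ n] mult_smult_distrib[of _ n n _ n])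
        (intro eq_matI, auto)
    also have "\<dots> = (c * (2 * a * c)) \<cdot>\<^sub>m ?M" unfolding MM using M by (intro eq_matI) (auto simp: mult_ac)
    finally show ?thesis unfolding c mat_idempotent_def using M by simp
  qed
  have "A = a \<cdot>\<^sub>m (c \<cdot>\<^sub>m (a \<cdot>\<^sub>m ?I + 1 \<cdot>\<^sub>m A + S)) + (- a) \<cdot>\<^sub>m (c \<cdot>\<^sub>m (a \<cdot>\<^sub>m ?I + (-1) \<cdot>\<^sub>m A + S))"
  proof (rule eq_matI, goal_cases)
    case (1 i j)
    have "A $$ (i, j) = (2 * a * c) * A $$ (i, j)" unfolding c by simp
    then show ?case using 1 A S by (auto simp: algebra_simps)
  qed (use A S in auto)
  then show ?thesis unfolding mat_composite_def using idem[of 1] idem[of "-1"] by auto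
qed

section \<open>Inequalities between nullities\<close>

text \<open>
  The source of all inequalities between \<open>n\<^sub>k(A, \<mu>)\<close> and \<open>n\<^sub>l(A, -\<mu>)\<close>. In terms of ranks, it says that
  passing from \<open>b\<close> to \<open>S b(A) S\<close> can only decrease the rank drop that a further factor causes,
  where \<open>m\<close> on the side of \<open>b\<close> turns into \<open>m(-X)\<close> when it is moved past \<open>S\<close>, and
  \<open>S b(A) S = s(A) b(-A)\<close>.
\<close>

lemma nullity_anticommute:
  fixes A :: "'a::field mat"
  assumes A: "A \<in> carrier_mat n n" and S: "S \<in> carrier_mat n n"
    and anti: "S * A = - (A * S)" and sq: "S * S = poly_mat A s"
  shows "nullity A (s * reflect b * reflect m) + nullity A b \<le> nullity A (s * reflect b) + nullity A (m * b)"
proof -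
  have comm: "S * poly_mat A p = poly_mat A (reflect p) * S" for p
  proof -
    have mA: "- A \<in> carrier_mat n n" using A by auto
    have "- A * S = S * A" using anti A S by simp
    from poly_mat_intertwine[OF mA A S this, of p] show ?thesis
      unfolding poly_mat_neg[OF A] by simp
  qed
  note as = assoc_mult_mat[of _ n n _ n _ n]
  let ?p = "poly_mat A"
  have pc: "?p p \<in> carrier_mat n n" for p using A by auto
  have e1: "?p (s * reflect b) = S * ?p b * S" 
    unfolding poly_mat_mult[OF A] sq[symmetric] using comm[of "reflect b"] S pc by (simp add: reflect_reflect as)
  have e2: "?p (s * reflect b * reflect m) = S * (?p b * S) * ?p (reflect m)"
    unfolding poly_mat_mult[OF A, of "s * reflect b"] e1 using S pc by (simp add: as)
  have e3: "?p m * ?p b * S = ?p b * S * ?p (reflect m)"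
    unfolding poly_mat_commute[OF A, of m b] using comm[of "reflect m"] S pc by (simp add: reflect_reflect as)
  have "kernel_dim (S * (?p b * S) * ?p (reflect m)) + kernel_dim (?p b * S)
      \<le> kernel_dim (?p b * S * ?p (reflect m)) + kernel_dim (S * (?p b * S))"
    by (rule kernel_dim_frobenius) (use S pc mult_carrier_mat[OF pc S] in auto)
  moreover have "kernel_dim (?p m * ?p b * S) + kernel_dim (?p b) \<le> kernel_dim (?p b * S) + kernel_dim (?p m * ?p b)"
    by (rule kernel_dim_frobenius) (use S pc mult_carrier_mat[OF pc S] in auto)
  moreover have "S * (?p b * S) = ?p (s * reflect b)" unfolding e1 using S pc by (simp add: as)
  ultimately show ?thesis unfolding nullity_def e2 e3 poly_mat_mult[OF A, of m b] by simp
qed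

lemma nullity_linear_coprime:
  assumes A: "A \<in> carrier_mat n n" and "poly q e \<noteq> 0"
  shows "nullity A ([:- e, 1:] ^ k * q) = nullity A ([:- e, 1:] ^ k) + nullity A q"
  using bezout_linear_power[OF assms(2), of k] nullity_coprime[OF A] by blast

lemma pcompose_power: "pcompose (p ^ k) q = pcompose p q ^ k"
  for p :: "'a::comm_semiring_1 poly"
  by (induct k) (simp_all add: pcompose_1 pcompose_mult)

lemma uminus_power_smult: "(- p) ^ k = smult ((-1) ^ k) (p ^ k)" for p :: "'a::comm_ring_1 poly"
  by (induct k) simp_all

text \<open>
  \<open>n\<^sub>k\<^sub>+\<^sub>1(A, e) \<le> n\<^sub>k\<^sub>+\<^sub>1(A, -e)\<close> for \<open>e \<noteq> \<plusminus>a\<close>, written without subtraction. It is \<open>nullity_anticommute\<close> with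
  \<open>b = (X + e)\<^sup>k\<close> and \<open>m = X + e\<close>; the factor \<open>a\<^sup>2 - X\<^sup>2\<close> is coprime to \<open>X - e\<close>, so it adds the same
  nullity to both sides.
\<close>

lemma anticommuting_nullity_other:
  fixes A :: "'a::field mat"
  assumes A: "A \<in> carrier_mat n n" and S: "S \<in> carrier_mat n n"
    and anti: "S * A = - (A * S)" and sq: "S * S = poly_mat A [:a\<^sup>2, 0, -1:]"
    and e: "e \<noteq> a" "e \<noteq> - a"
  shows "nullity A ([:- e, 1:] ^ Suc k) + nullity A ([:e, 1:] ^ k)
    \<le> nullity A ([:- e, 1:] ^ k) + nullity A ([:e, 1:] ^ Suc k)"
proof -
  let ?s = "[:a\<^sup>2, 0, -1:]"
  have r: "reflect [:e, 1:] = - [:- e, 1:]" by (simp add: pcompose_pCons)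
  have s: "poly ?s e \<noteq> 0"
  proof
    assume "poly ?s e = 0"
    then have "(a - e) * (a + e) = 0" by (simp add: algebra_simps power2_eq_square)
    then show False using e by (auto simp: add_eq_0_iff2)
  qed
  have *: "nullity A (?s * (- [:- e, 1:]) ^ j) = nullity A ?s + nullity A ([:- e, 1:] ^ j)" for j
  proof -
    have "?s * (- [:- e, 1:]) ^ j = smult ((-1) ^ j) ([:- e, 1:] ^ j * ?s)"
      unfolding uminus_power_smult by (simp only: mult_smult_right mult.commute)
    then show ?thesis using nullity_smult_unit[OF A, of "(-1)^j"] nullity_linear_coprime[OF A s] by simp
  qed
  have rb: "reflect ([:e, 1:] ^ k) = (- [:- e, 1:]) ^ k" unfolding pcompose_power r ..
  have "?s * (- [:- e, 1:]) ^ k * reflect [:e, 1:] = ?s * (- [:- e, 1:]) ^ Suc k"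
    unfolding r power_Suc2 by (rule mult.assoc)
  with nullity_anticommute[OF A S anti sq, of "[:e, 1:] ^ k" "[:e, 1:]"] show ?thesis
    unfolding rb power_Suc[symmetric] by (simp only: *)
qed

text \<open>
  \<open>n\<^sub>k\<^sub>+\<^sub>2(A, e) \<le> n\<^sub>k\<^sub>+\<^sub>1(A, -e)\<close> for \<open>e = \<plusminus>a\<close>, written without subtraction. Now
  \<open>a\<^sup>2 - X\<^sup>2 = - (X + e) (X - e)\<close> contributes a factor \<open>X - e\<close> itself, which accounts for the shift of
  the index. The choice \<open>b = ((X + e) (X - e))\<^sup>k\<close> is invariant under \<open>X \<mapsto> - X\<close>.
\<close>

lemma anticommuting_nullity_special:
  fixes A :: "'a::field mat"
  assumes A: "A \<in> carrier_mat n n" and S: "S \<in> carrier_mat n n"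
    and anti: "S * A = - (A * S)" and sq: "S * S = poly_mat A [:a\<^sup>2, 0, -1:]"
    and e: "e\<^sup>2 = a\<^sup>2" "e \<noteq> - e"
  shows "nullity A ([:- e, 1:] ^ Suc (Suc k)) + nullity A ([:e, 1:] ^ k)
    \<le> nullity A ([:- e, 1:] ^ Suc k) + nullity A ([:e, 1:] ^ Suc k)"
proof -
  let ?s = "[:a\<^sup>2, 0, -1:]"
  let ?m = "[:e, 1:]" and ?N = "[:- e, 1:]"
  have r: "reflect ?m = - ?N" by (simp add: pcompose_pCons)
  have r': "reflect ?N = - ?m" by (simp add: pcompose_pCons)
  have s: "?s = - (?m * ?N)" unfolding e(1)[symmetric] by (simp add: power2_eq_square)
  let ?b = "(?m * ?N) ^ k"
  have rb: "reflect ?b = ?b" unfolding pcompose_power pcompose_mult r r' by (simp add: mult.commute)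
  have *: "nullity A (?N ^ j * ?m ^ i) = nullity A (?N ^ j) + nullity A (?m ^ i)" for i j
    using e(2) by (intro nullity_linear_coprime[OF A]) (simp add: poly_power add_eq_0_iff2)
  have m: "nullity A (- p) = nullity A p" for p using nullity_smult_unit[OF A, of "-1" p] by simp
  \<comment> \<open>Written with \<open>?N\<close> and \<open>?m\<close>, the inequality splits into nullities at \<open>e\<close>
      and at \<open>- e\<close>; those of \<open>?N ^ k\<close> and \<open>?m ^ Suc k\<close> occur on both sides.\<close>
  have "nullity A (?s * reflect ?b * reflect ?m) + nullity A ?b \<le> nullity A (?s * reflect ?b) + nullity A (?m * ?b)"
    by (rule nullity_anticommute[OF A S anti sq])
  moreover have "?s * reflect ?b * reflect ?m = ?N ^ Suc (Suc k) * ?m ^ Suc k"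
    unfolding rb r s by (simp only: power_mult_distrib power_Suc mult_minus_left mult_minus_right minus_minus mult_ac)
  moreover have "?s * reflect ?b = - (?N ^ Suc k * ?m ^ Suc k)"
    unfolding rb s by (simp only: power_mult_distrib power_Suc mult_minus_left mult_minus_right mult_ac)
  moreover have "?m * ?b = ?N ^ k * ?m ^ Suc k" by (simp only: power_mult_distrib power_Suc mult_ac)
  moreover have "?b = ?N ^ k * ?m ^ k" by (simp only: power_mult_distrib mult_ac)
  ultimately show ?thesis by (simp only: * m)
qed

section \<open>Vectors with a prescribed annihilator\<close>

lemma poly_mat_vec_index:
  fixes A :: "'a::field mat"
  assumes A: "A \<in> carrier_mat n n" and v: "v \<in> carrier_vec n" and i: "i < n" and N: "degree p \<le> N"
  shows "(poly_mat A p *\<^sub>v v) $ i = (\<Sum>k\<le>N. coeff p k * (A ^\<^sub>m k *\<^sub>v v) $ i)"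
proof -
  have "(poly_mat A p *\<^sub>v v) $ i = (\<Sum>l<n. poly_mat A p $$ (i, l) * v $ l)"
    using A v i by (auto simp: scalar_prod_def lessThan_atLeast0)
  also have "\<dots> = (\<Sum>l<n. \<Sum>k\<le>N. coeff p k * ((A ^\<^sub>m k) $$ (i, l) * v $ l))"
    using poly_mat_index[OF A i _ N] by (intro sum.cong) (auto simp: sum_distrib_right mult.assoc)
  also have "\<dots> = (\<Sum>k\<le>N. coeff p k * (\<Sum>l<n. (A ^\<^sub>m k) $$ (i, l) * v $ l))"
    by (subst sum.swap) (simp add: sum_distrib_left)
  also have "\<dots> = (\<Sum>k\<le>N. coeff p k * (A ^\<^sub>m k *\<^sub>v v) $ i)"
  proof (intro sum.cong refl)
    fix k
    define B where "B = A ^\<^sub>m k"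
    have "B \<in> carrier_mat n n" using A by (auto simp: B_def)
    then show "coeff p k * (\<Sum>l<n. (A ^\<^sub>m k) $$ (i, l) * v $ l) = coeff p k * (A ^\<^sub>m k *\<^sub>v v) $ i"
      unfolding B_def[symmetric] using v i by (auto simp: scalar_prod_def lessThan_atLeast0)
  qed
  finally show ?thesis .
qed

lemma mat_eq_0_iff_unit_vecs:
  fixes A :: "'a::field mat"
  assumes A: "A \<in> carrier_mat n n"
  shows "A = 0\<^sub>m n n \<longleftrightarrow> (\<forall>j<n. A *\<^sub>v unit_vec n j = 0\<^sub>v n)"
proof
  assume "\<forall>j<n. A *\<^sub>v unit_vec n j = 0\<^sub>v n"
  then have *: "A *\<^sub>v unit_vec n j = 0\<^sub>v n" if "j < n" for j using that by blast
  show "A = 0\<^sub>m n n"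
  proof (rule eq_matI)
    fix i j assume ij: "i < dim_row (0\<^sub>m n n :: 'a mat)" "j < dim_col (0\<^sub>m n n :: 'a mat)"
    then have "A $$ (i,j) = (A *\<^sub>v unit_vec n j) $ i" using A by simp
    also have "\<dots> = 0" using ij by (subst *) auto
    finally show "A $$ (i,j) = 0\<^sub>m n n $$ (i,j)" using ij by simp
  qed (use A in auto)
qed (auto intro!: eq_vecI)

lemma irreducible_factor_split:
  fixes h p :: "'a::field poly"
  assumes "h \<noteq> 0" "irreducible p"
  shows "\<exists>a t. h = p ^ a * t \<and> \<not> p dvd t"
  using assms(1)
proof (induct "degree h" arbitrary: h rule: less_induct)
  case less
  have dp: "degree p > 0"
    using assms(2) by (metis gr0I irreducible_def is_unit_iff_degree)
  show ?case
  proof (cases "p dvd h")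
    case True
    then obtain k where k: "h = p * k" by (rule dvdE)
    then have "k \<noteq> 0" "degree k < degree h" using less(2) dp by (auto simp: degree_mult_eq)
    from less(1)[OF this(2,1)] obtain a t where "k = p ^ a * t" "\<not> p dvd t" by auto
    then show ?thesis unfolding k by (intro exI[of _ "Suc a"] exI[of _ t]) auto
  qed (auto intro: exI[of _ 0])
qed

lemma irreducible_power_bezout:
  fixes p t :: "'a::field poly"
  assumes p: "irreducible p" and "\<not> p dvd t"
  shows "\<exists>u v. u * p ^ a + v * t = 1"
proof (rule field_poly_bezout)
  show "p ^ a \<noteq> 0" using p by auto
next
  fix s assume s: "irreducible s" "s dvd p ^ a" "s dvd t"
  then have "s dvd p" using prime_elem_dvd_power[OF field_poly_irreducible_imp_prime] by blast
  then have "p dvd s" using s(1) p by (metis irreducibleD' irreducible_not_unit)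
  with s(3) assms(2) show False using dvd_trans by blast
qed

context
  fixes A :: "'a::field mat" and n :: nat
  assumes A: "A \<in> carrier_mat n n"
begin

lemma annihilates_mult:
  assumes v: "v \<in> carrier_vec n" and "poly_mat A p *\<^sub>v v = 0\<^sub>v n"
  shows "poly_mat A (q * p) *\<^sub>v v = 0\<^sub>v n"
proof -
  have c: "poly_mat A p \<in> carrier_mat n n" "poly_mat A q \<in> carrier_mat n n" using A by auto
  have "poly_mat A (q * p) *\<^sub>v v = poly_mat A q *\<^sub>v 0\<^sub>v n"
    unfolding poly_mat_mult[OF A] using c v assms(2) by (simp add: assoc_mult_mat_vec[of _ n n _ n])
  also have "\<dots> = 0\<^sub>v n" using c by (intro eq_vecI) auto
  finally show ?thesis .
qed

lemma annihilates_add: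
  assumes v: "v \<in> carrier_vec n" and "poly_mat A p *\<^sub>v v = 0\<^sub>v n" "poly_mat A q *\<^sub>v v = 0\<^sub>v n"
  shows "poly_mat A (p + q) *\<^sub>v v = 0\<^sub>v n"
proof -
  have c: "poly_mat A p \<in> carrier_mat n n" "poly_mat A q \<in> carrier_mat n n" using A by auto
  show ?thesis unfolding poly_mat_add[OF A] using c v assms by (simp add: add_mult_distrib_mat_vec[of _ n n])
qed

text \<open>
  The \<open>n + 1\<close> vectors \<open>v, A v, \<dots>, A\<^sup>n v\<close> are dependent.
\<close>

lemma ex_annihilator_vec:
  assumes v: "v \<in> carrier_vec n"
  shows "\<exists>p. p \<noteq> 0 \<and> poly_mat A p *\<^sub>v v = 0\<^sub>v n"
proof -
  define C where "C = mat n (Suc n) (\<lambda>(i, j). (A ^\<^sub>m j *\<^sub>v v) $ i)"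
  have C: "C \<in> carrier_mat n (Suc n)" by (simp add: C_def)
  have "\<exists>x\<in>carrier_vec (Suc n). C *\<^sub>v x = 0\<^sub>v n \<and> x \<noteq> 0\<^sub>v (Suc n)"
  proof (rule ccontr)
    assume "\<not> ?thesis"
    then have "x = 0\<^sub>v (Suc n)" if "x \<in> carrier_vec (Suc n)" "C *\<^sub>v x = 0\<^sub>v n" for x using that by blast
    from extend_to_invertible[OF C this] have "Suc n \<le> n" by metis
    then show False by simp
  qed
  then obtain x where x: "x \<in> carrier_vec (Suc n)" "C *\<^sub>v x = 0\<^sub>v n" "x \<noteq> 0\<^sub>v (Suc n)" by blast
  define p where "p = Poly (map (\<lambda>k. x $ k) [0..<Suc n])"
  have cp: "coeff p k = (if k < Suc n then x $ k else 0)" for k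
    unfolding p_def coeff_Poly_eq by (simp add: nth_default_def del: upt_Suc)
  have "p \<noteq> 0"
  proof
    assume "p = 0"
    then have "x $ k = 0" if "k < Suc n" for k using cp[of k] that by simp
    then have "x = 0\<^sub>v (Suc n)" using x(1) by (intro eq_vecI) auto
    with x(3) show False by simp
  qed
  moreover have "degree p \<le> n" by (rule degree_le) (simp add: cp)
  then have "(poly_mat A p *\<^sub>v v) $ i = (C *\<^sub>v x) $ i" if "i < n" for i
    using that x(1) unfolding poly_mat_vec_index[OF A v that \<open>degree p \<le> n\<close>]
    by (auto simp: cp C_def scalar_prod_def lessThan_Suc_atMost[symmetric] lessThan_atLeast0 mult.commute
        simp del: sum.lessThan_Suc sum.op_ivl_Suc intro!: sum.cong)
  then have "poly_mat A p *\<^sub>v v = 0\<^sub>v n" unfolding x(2) using A by (intro eq_vecI) auto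
  ultimately show ?thesis by blast
qed

lemma ex_annihilator: "\<exists>p. p \<noteq> 0 \<and> poly_mat A p = 0\<^sub>m n n"
proof -
  obtain P where P: "\<And>j. j < n \<Longrightarrow> P j \<noteq> 0 \<and> poly_mat A (P j) *\<^sub>v unit_vec n j = 0\<^sub>v n"
    using ex_annihilator_vec[OF unit_vec_carrier] by metis
  define p where "p = (\<Prod>j<n. P j)"
  have "p \<noteq> 0" using P by (auto simp: p_def)
  moreover have "poly_mat A p *\<^sub>v unit_vec n j = 0\<^sub>v n" if "j < n" for j
  proof -
    have "p = (\<Prod>i\<in>{..<n} - {j}. P i) * P j" unfolding p_def using that by (subst prod.remove[of _ j]) auto
    then show ?thesis using annihilates_mult[of "unit_vec n j" "P j"] P[OF that] by simp
  qed
  then have "poly_mat A p = 0\<^sub>m n n" using A mat_eq_0_iff_unit_vecs[of "poly_mat A p" n] by auto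
  ultimately show ?thesis by blast
qed

lemma minimal_polynomial_exists:
  "\<exists>f. monic f \<and> (\<forall>g. poly_mat A g = 0\<^sub>m n n \<longleftrightarrow> f dvd g)"
proof -
  let ?P = "\<lambda>p. p \<noteq> 0 \<and> poly_mat A p = 0\<^sub>m n n"
  obtain h where h: "?P h" and min: "\<And>g. ?P g \<Longrightarrow> degree h \<le> degree g"
    using ex_has_least_nat[of ?P] ex_annihilator by metis
  define f where "f = smult (inverse (lead_coeff h)) h"
  have f: "monic f" "degree f = degree h" using h by (auto simp: f_def)
  have pf: "poly_mat A f = 0\<^sub>m n n" using h by (auto simp: f_def poly_mat_smult[OF A])
  have "f dvd g" if g: "poly_mat A g = 0\<^sub>m n n" for g
  proof (rule ccontr)
    assume nd: "\<not> f dvd g"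
    have e: "g mod f = g + - (g div f * f)" by (simp add: minus_div_mult_eq_mod)
    have "poly_mat A (g mod f) = 0\<^sub>m n n"
      unfolding e poly_mat_add[OF A] poly_mat_uminus[OF A] poly_mat_mult[OF A] g pf
        right_mult_zero_mat[OF poly_mat_carrier[OF A]] by (intro eq_matI) auto
    then have "degree h \<le> degree (g mod f)" using min nd by (auto simp: dvd_eq_mod_eq_0)
    moreover have "f \<noteq> 0" using f(1) by auto
    ultimately show False using degree_mod_less[of f g] nd f(2) by (auto simp: dvd_eq_mod_eq_0)
  qed
  moreover have "poly_mat A (f * q) = 0\<^sub>m n n" for q
    using A pf by (simp add: poly_mat_mult[OF A] left_mult_zero_mat[OF poly_mat_carrier[OF A]])
  ultimately show ?thesis using f(1) by (auto elim!: dvdE)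
qed

text \<open>
  Write \<open>f = p\<^sup>a\<^sup>+\<^sup>1 k\<close>. Since \<open>(p\<^sup>a k)(A) \<noteq> 0\<close>, there is a unit vector \<open>w\<close> with \<open>(p\<^sup>a k)(A) w \<noteq> 0\<close>,
  and then \<open>k(A) w\<close> is killed by \<open>p\<^sup>a\<^sup>+\<^sup>1\<close> but not by \<open>p\<^sup>a\<close>.
\<close>

lemma vector_with_prime_power_annihilator:
  assumes f: "\<And>g. poly_mat A g = 0\<^sub>m n n \<longleftrightarrow> f dvd g" "f \<noteq> 0"
    and p: "irreducible p" and pf: "p ^ Suc a dvd f"
  shows "\<exists>v\<in>carrier_vec n. \<forall>g. poly_mat A g *\<^sub>v v = 0\<^sub>v n \<longleftrightarrow> p ^ Suc a dvd g"
proof -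
  obtain k where k: "f = p ^ Suc a * k" using pf by (rule dvdE)
  have p0: "p \<noteq> 0" and k0: "k \<noteq> 0" using p k f(2) by auto
  have "\<not> f dvd p ^ a * k"
  proof
    assume "f dvd p ^ a * k"
    then have "p * (p ^ a * k) dvd 1 * (p ^ a * k)" unfolding k by (simp add: mult_ac)
    then have "p dvd 1" using p0 k0 by (subst (asm) dvd_mult_cancel_right) auto
    then show False using p by (simp add: irreducible_def)
  qed
  then obtain w where w: "w \<in> carrier_vec n" "poly_mat A (p ^ a * k) *\<^sub>v w \<noteq> 0\<^sub>v n"
    using f(1) A mat_eq_0_iff_unit_vecs[of "poly_mat A (p ^ a * k)" n] by (metis poly_mat_carrier unit_vec_carrier)
  define v where "v = poly_mat A k *\<^sub>v w"
  have kc: "poly_mat A q \<in> carrier_mat n n" for q using A by auto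
  have v: "v \<in> carrier_vec n" unfolding v_def by (rule mult_mat_vec_carrier[OF kc w(1)])
  have pv: "poly_mat A g *\<^sub>v v = poly_mat A (g * k) *\<^sub>v w" for g
    unfolding v_def poly_mat_mult[OF A] using kc w by (simp add: assoc_mult_mat_vec[of _ n n _ n])
  have z: "0\<^sub>m n n *\<^sub>v w = 0\<^sub>v n" using w(1) by (intro eq_vecI) auto
  have "p ^ Suc a dvd g" if g: "poly_mat A g *\<^sub>v v = 0\<^sub>v n" for g
  proof (rule ccontr)
    assume nd: "\<not> p ^ Suc a dvd g"
    then have "g \<noteq> 0" by auto
    from irreducible_factor_split[OF this p] obtain c r where g_eq: "g = p ^ c * r" and r: "\<not> p dvd r" by auto
    have "c \<le> a"
    proof (rule ccontr)
      assume "\<not> c \<le> a"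
      then have "p ^ Suc a dvd p ^ c" by (intro le_imp_power_dvd) auto
      then show False using nd g_eq by auto
    qed
    obtain u y where uy: "u * p ^ Suc a + y * r = 1" using irreducible_power_bezout[OF p r] by metis
    have "p ^ a = p ^ (a - c) * p ^ c * (u * p ^ Suc a + y * r)"
      using \<open>c \<le> a\<close> unfolding uy by (simp flip: power_add)
    also have "\<dots> = (p ^ (a - c) * p ^ c * u) * p ^ Suc a + (p ^ (a - c) * y) * g"
      unfolding g_eq by (simp add: algebra_simps)
    finally have eq: "p ^ a = \<dots>" .
    have "poly_mat A (p ^ Suc a) *\<^sub>v v = 0\<^sub>v n"
      unfolding pv k[symmetric] using f(1)[of f] z by simp
    then have "poly_mat A (p ^ a) *\<^sub>v v = 0\<^sub>v n"
      by (subst eq) (intro annihilates_add annihilates_mult v g)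
    then show False using w pv by simp
  qed
  moreover have "poly_mat A g *\<^sub>v v = 0\<^sub>v n" if "p ^ Suc a dvd g" for g
  proof -
    have "f dvd g * k" unfolding k using that by (intro mult_dvd_mono) auto
    then have "poly_mat A (g * k) = 0\<^sub>m n n" using f(1) by blast
    then show ?thesis unfolding pv using z by simp
  qed
  ultimately show ?thesis using v by blast
qed

text \<open>
  For \<open>h = f\<close> the vector has the minimal polynomial of the matrix as its own annihilator; it generates
  the largest cyclic subspace. The proof adds up vectors for the prime powers in \<open>h\<close>, whose
  annihilators are pairwise coprime. This argument works over finite fields too, where a vector
  in general position need not exist.
\<close>

lemma vector_with_divisor_annihilator:
  assumes f: "\<And>g. poly_mat A g = 0\<^sub>m n n \<longleftrightarrow> f dvd g" "f \<noteq> 0" and "h dvd f"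
  shows "\<exists>v\<in>carrier_vec n. \<forall>g. poly_mat A g *\<^sub>v v = 0\<^sub>v n \<longleftrightarrow> h dvd g"
  using assms(3)
proof (induct "degree h" arbitrary: h rule: less_induct)
  case less
  have h0: "h \<noteq> 0" using less(2) f(2) by auto
  have kc: "poly_mat A q \<in> carrier_mat n n" for q using A by auto
  show ?case
  proof (cases "degree h = 0")
    case True
    then have "h dvd g" for g using h0 by (meson is_unit_iff_degree one_dvd dvd_trans)
    moreover have "poly_mat A g *\<^sub>v 0\<^sub>v n = 0\<^sub>v n" for g using kc[of g] by (intro eq_vecI) auto
    ultimately show ?thesis by (intro bexI[of _ "0\<^sub>v n"]) auto
  next
    case False
    then obtain p where p: "irreducible p" "p dvd h" using irreducible\<^sub>d_factor[of h] by auto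
    from irreducible_factor_split[OF h0 p(1)] obtain b t where ht: "h = p ^ b * t" and t: "\<not> p dvd t" by auto
    then obtain a where b: "b = Suc a" using p(2) by (cases b) auto
    have dp: "degree p > 0" using p(1) by (metis gr0I irreducible_def is_unit_iff_degree)
    have t0: "t \<noteq> 0" and p0: "p \<noteq> 0" using h0 ht p(1) by auto
    have "degree t < degree h" unfolding ht b using t0 p0 dp
      by (simp add: degree_mult_eq degree_power_eq)
    moreover have "t dvd f" using less(2) ht dvd_mult_right by blast
    ultimately obtain v2 where v2: "v2 \<in> carrier_vec n" "\<And>g. poly_mat A g *\<^sub>v v2 = 0\<^sub>v n \<longleftrightarrow> t dvd g"
      using less(1) by blast
    have "p ^ Suc a dvd f" using less(2) ht b dvd_mult_left by blast
    from vector_with_prime_power_annihilator[OF f p(1) this]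
    obtain v1 where v1: "v1 \<in> carrier_vec n" "\<And>g. poly_mat A g *\<^sub>v v1 = 0\<^sub>v n \<longleftrightarrow> p ^ Suc a dvd g" by blast
    obtain u y where uy: "u * p ^ Suc a + y * t = 1" using irreducible_power_bezout[OF p(1) t] by metis
    have sum: "poly_mat A g *\<^sub>v (v1 + v2) = poly_mat A g *\<^sub>v v1 + poly_mat A g *\<^sub>v v2" for g
      by (rule mult_add_distrib_mat_vec[OF kc v1(1) v2(1)])
    have "h dvd g" if g: "poly_mat A g *\<^sub>v (v1 + v2) = 0\<^sub>v n" for g
    proof -
      have tg: "poly_mat A (q * g) *\<^sub>v v1 + poly_mat A (q * g) *\<^sub>v v2 = 0\<^sub>v n" for q
        using annihilates_mult[OF _ g, of q] v1 v2 sum by simp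
      have "poly_mat A (t * g) *\<^sub>v v2 = 0\<^sub>v n" using v2(2) by simp
      then have "poly_mat A (t * g) *\<^sub>v v1 = 0\<^sub>v n"
        using tg[of t] mult_mat_vec_carrier[OF kc v1(1)] by simp
      then have "p ^ Suc a dvd t * g" using v1(2) by simp
      have "poly_mat A (p ^ Suc a * g) *\<^sub>v v1 = 0\<^sub>v n" using v1(2) by simp
      then have "poly_mat A (p ^ Suc a * g) *\<^sub>v v2 = 0\<^sub>v n"
        using tg[of "p ^ Suc a"] mult_mat_vec_carrier[OF kc v2(1)] by simp
      then have "t dvd p ^ Suc a * g" using v2(2) by simp
      have "g = g * (u * p ^ Suc a + y * t)" unfolding uy by simp
      also have "\<dots> = u * (p ^ Suc a * g) + y * (t * g)" by (simp add: algebra_simps)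
      finally have e: "g = u * (p ^ Suc a * g) + y * (t * g)" .
      have "t dvd u * (p ^ Suc a * g) + y * (t * g)"
        by (rule dvd_add[OF dvd_mult[OF \<open>t dvd p ^ Suc a * g\<close>] dvd_mult[OF dvd_triv_left]])
      with e have tg': "t dvd g" by simp
      have "p ^ Suc a dvd u * (p ^ Suc a * g) + y * (t * g)"
        by (rule dvd_add[OF dvd_mult[OF dvd_triv_left] dvd_mult[OF \<open>p ^ Suc a dvd t * g\<close>]])
      with e have pg: "p ^ Suc a dvd g" by simp
      have "h dvd p ^ Suc a * g" unfolding ht b by (rule mult_dvd_mono[OF dvd_refl tg'])
      moreover have "h dvd g * t" unfolding ht b by (rule mult_dvd_mono[OF pg dvd_refl])
      ultimately have "h dvd u * (p ^ Suc a * g) + y * (t * g)"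
        by (simp only: dvd_add dvd_mult mult.commute[of t g])
      with e show ?thesis by simp
    qed
    moreover have "poly_mat A g *\<^sub>v (v1 + v2) = 0\<^sub>v n" if "h dvd g" for g
    proof -
      have "p ^ Suc a dvd g" "t dvd g" using that ht b dvd_mult_left dvd_mult_right by blast+
      then have "poly_mat A g *\<^sub>v v1 = 0\<^sub>v n" "poly_mat A g *\<^sub>v v2 = 0\<^sub>v n" using v1(2) v2(2) by blast+
      then show ?thesis unfolding sum by simp
    qed
    ultimately show ?thesis using v1(1) v2(1) by (intro bexI[of _ "v1 + v2"]) auto
  qed
qed

end

section \<open>Splitting off a companion block\<close>

text \<open>
  The shape in which row \<open>0\<close> is a cyclic row vector: row \<open>0\<close> of the \<open>i\<close>-th power is the unit vector
  \<open>e\<^sub>i\<close>. So, for monic \<open>f\<close>, row \<open>0\<close> of \<open>g (companion f)\<close> lists the coefficients of \<open>g\<close> modulo \<open>f\<close>.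
\<close>

definition companion :: "'a::field poly \<Rightarrow> 'a mat" where
  "companion f = mat (degree f) (degree f)
     (\<lambda>(i, j). if Suc i < degree f then (if j = Suc i then 1 else 0) else - coeff f j)"

lemma companion_carrier [simp, intro]: "companion f \<in> carrier_mat (degree f) (degree f)"
  by (simp add: companion_def)

lemma companion_pow_row0:
  assumes "i < degree f" "j < degree f"
  shows "(companion f ^\<^sub>m i) $$ (0, j) = (if i = j then 1 else 0)"
  using assms
proof (induct i arbitrary: j)
  case 0
  then show ?case by (simp add: companion_def)
next
  case (Suc i)
  define B where "B = companion f ^\<^sub>m i"
  have B: "B \<in> carrier_mat (degree f) (degree f)" by (auto simp: B_def)
  have "(companion f ^\<^sub>m Suc i) $$ (0, j) = (\<Sum>l<degree f. B $$ (0, l) * companion f $$ (l, j))"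
    using Suc(2,3) B unfolding pow_mat.simps B_def[symmetric]
    by (auto simp: scalar_prod_def lessThan_atLeast0 companion_def intro!: sum.cong)
  also have "\<dots> = (\<Sum>l<degree f. if i = l then companion f $$ (l, j) else 0)"
    using Suc by (intro sum.cong) (auto simp: B_def)
  also have "\<dots> = companion f $$ (i, j)" using Suc(2) by simp
  finally show ?case using Suc(2,3) by (auto simp: companion_def)
qed

lemma poly_mat_companion_row0:
  assumes "degree g < degree f" "j < degree f"
  shows "poly_mat (companion f) g $$ (0, j) = coeff g j"
proof -
  obtain d where d: "degree f = Suc d" using assms by (cases "degree f") auto
  have "poly_mat (companion f) g $$ (0, j) = (\<Sum>k\<le>d. coeff g k * (companion f ^\<^sub>m k) $$ (0, j))"
    by (rule poly_mat_index[OF companion_carrier]) (use assms d in auto)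
  also have "\<dots> = (\<Sum>k\<le>d. if k = j then coeff g k else 0)"
    using companion_pow_row0[of _ f j] assms d by (intro sum.cong) auto
  also have "\<dots> = coeff g j" using assms d by simp
  finally show ?thesis .
qed

text \<open>
  Row \<open>0\<close> of \<open>g (companion f)\<close> lists the coefficients of \<open>g\<close>. As the field is arbitrary, this applies
  after every extension of scalars, where it keeps \<open>f\<close> the minimal polynomial of its companion matrix.
\<close>

lemma companion_annihilator_degree:
  assumes "poly_mat (companion f) g = 0\<^sub>m (degree f) (degree f)" "degree g < degree f"
  shows "g = 0"
proof (rule poly_eqI)
  fix j show "coeff g j = coeff 0 j"
  proof (cases "j < degree f")
    case True
    then show ?thesis using poly_mat_companion_row0[OF assms(2) True] assms(1) by simp
  next
    case False
    then show ?thesis using assms(2) by (simp add: coeff_eq_0)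
  qed
qed

lemma companion_map_poly_to_ac: "companion (map_poly to_ac f) = map_mat to_ac (companion f)"
  by (intro eq_matI) (auto simp: companion_def degree_map_poly coeff_map_poly)

text \<open>
  Let \<open>v\<close> have annihilator \<open>f\<close>, the minimal polynomial of degree \<open>d\<close>. In a basis that starts with
  \<open>A\<^sup>d\<^sup>-\<^sup>1 v, \<dots>, A v, v\<close> the matrix is block upper triangular. An invariant complement is the common
  kernel of the functionals \<open>\<phi>, \<phi> A, \<dots>, \<phi> A\<^sup>d\<^sup>-\<^sup>1\<close>, where \<open>\<phi>\<close> reads off the coordinate of \<open>A\<^sup>d\<^sup>-\<^sup>1 v\<close>: it
  is invariant since \<open>\<phi> A\<^sup>d\<close> is a combination of these functionals by \<open>f(A) = 0\<close>, and it is a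
  complement since their values on \<open>A\<^sup>d\<^sup>-\<^sup>1 v, \<dots>, v\<close> form a unitriangular matrix. Using the functionals
  as the first \<open>d\<close> coordinates turns the first block into \<open>companion f\<close>.
\<close>

lemma companion_splitting:
  fixes A :: "'a::field mat"
  assumes A: "A \<in> carrier_mat n n" and n: "n > 0"
  obtains f B where "monic f" "0 < degree f" "degree f \<le> n" "B \<in> carrier_mat (n - degree f) (n - degree f)"
    "similar_mat A (four_block_mat (companion f) (0\<^sub>m (degree f) (n - degree f)) (0\<^sub>m (n - degree f) (degree f)) B)"
    "poly_mat A f = 0\<^sub>m n n"
proof -
  obtain f where f: "monic f" "\<And>g. poly_mat A g = 0\<^sub>m n n \<longleftrightarrow> f dvd g"
    using minimal_polynomial_exists[OF A] by blast
  define d where "d = degree f"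
  have pf: "poly_mat A f = 0\<^sub>m n n" using f(2) by simp
  have f0: "f \<noteq> 0" using f(1) by auto
  have d0: "d > 0"
  proof (rule ccontr)
    assume "\<not> d > 0"
    then have "f = 1" using monic_degree_0[OF f(1)] by (simp add: d_def)
    then have "(1\<^sub>m n :: 'a mat) $$ (0,0) = 0\<^sub>m n n $$ (0,0)" using pf A by simp
    then show False using n by simp
  qed
  obtain v where v: "v \<in> carrier_vec n" "\<And>g. poly_mat A g *\<^sub>v v = 0\<^sub>v n \<longleftrightarrow> f dvd g"
    using vector_with_divisor_annihilator[OF A f(2) f0 dvd_refl] by blast
  \<comment> \<open>The vectors \<open>A\<^sup>k v\<close>, in decreasing order of \<open>k\<close> as columns of
      \<open>C\<close>; they are independent since no polynomial of degree below \<open>d\<close> annihilates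
      \<open>v\<close>.\<close>
  define K where "K = (\<lambda>k. A ^\<^sub>m k *\<^sub>v v)"
  have Kc: "K k \<in> carrier_vec n" for k using A v(1) pow_carrier_mat[OF A, of k] unfolding K_def
    by (intro mult_mat_vec_carrier)
  have KS: "A *\<^sub>v K k = K (Suc k)" for k
  proof -
    have "A * A ^\<^sub>m k = A ^\<^sub>m Suc k"
      using poly_mat_commute[OF A, of "[:0, 1:]" "[:0, 1:] ^ k"]
      unfolding poly_mat_power[OF A] poly_mat_X[OF A] by simp
    then show ?thesis unfolding K_def
      using assoc_mult_mat_vec[OF A pow_carrier_mat[OF A, of k] v(1)] by simp
  qed
  have pK: "(poly_mat A g *\<^sub>v v) $ i = (\<Sum>k\<le>N. coeff g k * K k $ i)" if "i < n" "degree g \<le> N" for g i N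
    using poly_mat_vec_index[OF A v(1) that] by (simp add: K_def)
  define C where "C = mat n d (\<lambda>(i, j). K (d - Suc j) $ i)"
  have C: "C \<in> carrier_mat n d" by (simp add: C_def)
  have Cx: "(C *\<^sub>v x) $ i = (\<Sum>k<d. x $ (d - Suc k) * K k $ i)" if "x \<in> carrier_vec d" "i < n" for x i
  proof -
    have "(C *\<^sub>v x) $ i = (\<Sum>j<d. x $ j * K (d - Suc j) $ i)"
      using that by (auto simp: C_def scalar_prod_def lessThan_atLeast0 mult.commute)
    also have "\<dots> = (\<Sum>k<d. x $ (d - Suc k) * K (d - Suc (d - Suc k)) $ i)"
      by (rule sum.nat_diff_reindex[symmetric])
    also have "\<dots> = (\<Sum>k<d. x $ (d - Suc k) * K k $ i)" by (intro sum.cong) auto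
    finally show ?thesis .
  qed
  have inj: "x = 0\<^sub>v d" if x: "x \<in> carrier_vec d" "C *\<^sub>v x = 0\<^sub>v n" for x
  proof -
    define p where "p = Poly (map (\<lambda>k. x $ (d - Suc k)) [0..<d])"
    have cp: "coeff p k = (if k < d then x $ (d - Suc k) else 0)" for k
      unfolding p_def coeff_Poly_eq by (simp add: nth_default_def)
    have dp: "degree p \<le> d - 1" by (rule degree_le) (use d0 in \<open>auto simp: cp\<close>)
    have "(poly_mat A p *\<^sub>v v) $ i = 0" if i: "i < n" for i
    proof -
      have "(poly_mat A p *\<^sub>v v) $ i = (\<Sum>k\<le>d - 1. coeff p k * K k $ i)" by (rule pK[OF i dp])
      also have "\<dots> = (\<Sum>k<d. x $ (d - Suc k) * K k $ i)" using d0 by (intro sum.cong) (auto simp: cp)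
      also have "\<dots> = 0" using Cx[OF x(1) i] x(2) i by simp
      finally show ?thesis .
    qed
    then have "poly_mat A p *\<^sub>v v = 0\<^sub>v n" using A by (intro eq_vecI) auto
    then have "f dvd p" using v(2) by simp
    then have p0: "p = 0" using dp d0 dvd_imp_degree_le[of f p] unfolding d_def by linarith
    show ?thesis
    proof (rule eq_vecI)
      fix j assume "j < dim_vec (0\<^sub>v d :: 'a vec)"
      then show "x $ j = 0\<^sub>v d $ j" using cp[of "d - Suc j"] p0 by simp
    qed (use x in auto)
  qed
  from extend_to_invertible[OF C inj] obtain P Q where P: "P \<in> carrier_mat n n" and Q: "Q \<in> carrier_mat n n"
    and PQ: "P * Q = 1\<^sub>m n" "Q * P = 1\<^sub>m n" and dn: "d \<le> n" and cP: "\<And>j. j < d \<Longrightarrow> col P j = col C j"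
    by metis
  \<comment> \<open>The matrix in the new basis: it shifts the first \<open>d\<close> basis vectors down and leaves their span
      invariant.\<close>
  define T where "T = Q * A * P"
  have T: "T \<in> carrier_mat n n" using P Q A by (auto simp: T_def)
  have "P * T * Q = (P * Q) * A * (P * Q)" unfolding T_def using P Q A
    by (simp add: assoc_mult_mat[of _ n n _ n _ n])
  then have AT: "similar_mat A T" using PQ A T P Q by (intro similar_matI[of _ _ P Q n]) auto
  have QA: "Q * A \<in> carrier_mat n n" using Q A by auto
  have QC: "Q *\<^sub>v col C j = unit_vec n j" if "j < d" for j
  proof -
    have "Q *\<^sub>v col C j = col (Q * P) j" unfolding cP[OF that, symmetric]
      using that dn by (intro col_mult2[OF Q P, symmetric]) auto
    then show ?thesis using PQ that dn by simp
  qed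
  have colC: "col C j = K (d - Suc j)" if "j < d" for j
    using that Kc[of "d - Suc j"] by (intro eq_vecI) (auto simp: C_def)
  have colT: "col T j = Q *\<^sub>v K (d - j)" if "j < d" for j
  proof -
    have "col T j = Q * A *\<^sub>v col C j" unfolding T_def cP[OF that, symmetric]
      using that dn by (intro col_mult2[OF QA P]) auto
    also have "\<dots> = Q *\<^sub>v K (Suc (d - Suc j))"
      unfolding colC[OF that] KS[symmetric] by (rule assoc_mult_mat_vec[OF Q A Kc])
    finally show ?thesis using that by (simp add: Suc_diff_Suc)
  qed
  have T_shift: "T $$ (i, Suc j) = (if i = j then 1 else 0)" if "Suc j < d" "i < n" for i j
  proof -
    have "T $$ (i, Suc j) = col T (Suc j) $ i" using that dn T by simp
    also have "col T (Suc j) = unit_vec n j"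
      unfolding colT[OF that(1)] using QC[of j] colC[of j] that by simp
    finally show ?thesis using that dn by auto
  qed
  have T_first: "T $$ (i, 0) = 0" if "d \<le> i" "i < n" for i
  proof -
    have "T $$ (i, 0) = col T 0 $ i" using that T n by simp
    also have "col T 0 = Q *\<^sub>v K d" using colT[of 0] d0 by simp
    also have "K d = C *\<^sub>v vec d (\<lambda>j. - coeff f (d - Suc j))"
    proof (rule eq_vecI)
      fix i assume "i < dim_vec (C *\<^sub>v vec d (\<lambda>j. - coeff f (d - Suc j)))"
      then have i: "i < n" using C by simp
      have "0 = (\<Sum>k\<le>d. coeff f k * K k $ i)"
        using pK[of i f d] i v(2)[of f] by (simp add: d_def)
      also have "\<dots> = (\<Sum>k<d. coeff f k * K k $ i) + K d $ i"
        using f(1) by (simp add: lessThan_Suc_atMost[symmetric] d_def)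
      finally have "K d $ i = - (\<Sum>k<d. coeff f k * K k $ i)" by (simp add: eq_neg_iff_add_eq_0 add.commute)
      also have "\<dots> = (C *\<^sub>v vec d (\<lambda>j. - coeff f (d - Suc j))) $ i"
        using i by (subst Cx) (auto simp: sum_negf[symmetric] intro!: sum.cong)
      finally show "K d $ i = (C *\<^sub>v vec d (\<lambda>j. - coeff f (d - Suc j))) $ i" .
    qed (use Kc[of d] C in auto)
    also have "Q *\<^sub>v (C *\<^sub>v vec d (\<lambda>j. - coeff f (d - Suc j))) = Q * C *\<^sub>v vec d (\<lambda>j. - coeff f (d - Suc j))"
      by (rule assoc_mult_mat_vec[OF Q C, symmetric]) auto
    also have "\<dots> $ i = 0"
    proof -
      define W where "W = Q * C"
      have W: "W \<in> carrier_mat n d" using Q C by (auto simp: W_def)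
      have "W $$ (i, j) = 0" if j: "j < d" for j
      proof -
        have "col W j = unit_vec n j"
          unfolding W_def using j C col_mult2[OF Q C, of j] QC[OF j] by simp
        then have "col W j $ i = (0 :: 'a)" using j \<open>d \<le> i\<close> \<open>i < n\<close> by simp
        then show ?thesis using W j \<open>i < n\<close> by simp
      qed
      then have "row W i $ j = 0" if "j < d" for j using that W \<open>i < n\<close> by simp
      then show ?thesis unfolding W_def[symmetric] using W \<open>i < n\<close>
        by (simp add: scalar_prod_def)
    qed
    finally show ?thesis .
  qed
  have T_low: "T $$ (i, j) = 0" if "d \<le> i" "i < n" "j < d" for i j
    using that T_first T_shift by (cases j) auto
  \<comment> \<open>Row \<open>0\<close> of \<open>T\<^sup>i\<close> is the functional \<open>\<phi> A\<^sup>i\<close> in the new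
      coordinates, \<open>\<phi>\<close> being the first coordinate.\<close>
  define \<rho> where "\<rho> = (\<lambda>i j. (T ^\<^sub>m i) $$ (0, j))"
  have \<rho>_Suc: "\<rho> (Suc i) j = (\<Sum>l<n. \<rho> i l * T $$ (l, j))" if "j < n" for i j
  proof -
    define B where "B = T ^\<^sub>m i"
    have B: "B \<in> carrier_mat n n" using T by (auto simp: B_def)
    show ?thesis using that n T B unfolding \<rho>_def pow_mat.simps B_def[symmetric]
      by (auto simp: scalar_prod_def lessThan_atLeast0 intro!: sum.cong)
  qed
  have \<rho>_diag: "\<rho> i j = (if i = j then 1 else 0)" if "i \<le> j" "j < d" for i j
    using that
  proof (induct i arbitrary: j)
    case 0
    then show ?case using T dn n by (auto simp: \<rho>_def)
  next
    case (Suc i)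
    then obtain j' where j: "j = Suc j'" by (cases j) auto
    have jn: "j < n" using Suc dn by simp
    have "\<rho> (Suc i) j = (\<Sum>l<n. if l = j' then \<rho> i l else 0)"
      unfolding \<rho>_Suc[OF jn] using T_shift[of j'] Suc(3) j by (intro sum.cong) auto
    also have "\<dots> = \<rho> i j'" using jn j by simp
    also have "\<dots> = (if i = j' then 1 else 0)" using Suc j by (intro Suc(1)) auto
    finally show ?case using j by simp
  qed
  have \<rho>_d: "\<rho> d j = (\<Sum>k<d. - coeff f k * \<rho> k j)" if "j < n" for j
  proof -
    have "nullity A f = n" unfolding nullity_def pf by (rule kernel_dim_0)
    then have "nullity T f = n" unfolding nullity_similar[OF A AT] .
    then have pT: "poly_mat T f = 0\<^sub>m n n" by (rule nullity_full_imp_0[OF T])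
    have "poly_mat T f $$ (0, j) = (\<Sum>k\<le>d. coeff f k * \<rho> k j)"
      unfolding \<rho>_def by (rule poly_mat_index[OF T n that]) (simp add: d_def)
    then have "0 = (\<Sum>k\<le>d. coeff f k * \<rho> k j)"
      unfolding pT using n that by simp
    also have "\<dots> = (\<Sum>k<d. coeff f k * \<rho> k j) + \<rho> d j"
      using f(1) by (simp add: lessThan_Suc_atMost[symmetric] d_def)
    finally show ?thesis by (simp add: sum_negf eq_neg_iff_add_eq_0 add.commute)
  qed
  \<comment> \<open>The second change of coordinates replaces the first \<open>d\<close> coordinates by these functionals.\<close>
  define G where "G = mat n n (\<lambda>(i, j). if i < d then \<rho> i j else if i = j then 1 else 0)"
  have G: "G \<in> carrier_mat n n" by (simp add: G_def)
  define R1 where "R1 = mat d d (\<lambda>(i, j). \<rho> i j)"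
  define R2 where "R2 = mat d (n - d) (\<lambda>(i, j). \<rho> i (j + d))"
  have R: "R1 \<in> carrier_mat d d" "R2 \<in> carrier_mat d (n - d)" by (auto simp: R1_def R2_def)
  have "G = four_block_mat R1 R2 (0\<^sub>m (n - d) d) (1\<^sub>m (n - d))"
    using dn by (intro eq_matI) (auto simp: G_def R1_def R2_def)
  then have "det G = det R1"
    using det_four_block_mat_lower_left_zero[OF R refl one_carrier_mat] by simp
  also have "\<dots> = prod_list (diag_mat R1)"
    by (rule det_lower_triangular[OF _ R(1)]) (auto simp: R1_def \<rho>_diag)
  also have "diag_mat R1 = map (\<lambda>i. 1) [0..<d]"
    unfolding diag_mat_def using R by (intro map_cong) (auto simp: R1_def \<rho>_diag)
  also have "prod_list \<dots> = 1" by (induct d) auto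
  finally have "det G \<noteq> 0" by simp
  from det_nonzero_obtain_inverse[OF G this] obtain H where H: "H \<in> carrier_mat n n"
    and GH: "G * H = 1\<^sub>m n" "H * G = 1\<^sub>m n" .
  define B where "B = mat (n - d) (n - d) (\<lambda>(i, j). T $$ (i + d, j + d))"
  have B: "B \<in> carrier_mat (n - d) (n - d)" by (simp add: B_def)
  define N where "N = four_block_mat (companion f) (0\<^sub>m d (n - d)) (0\<^sub>m (n - d) d) B"
  have N: "N \<in> carrier_mat n n"
    using four_block_carrier_mat[OF companion_carrier[of f] B] dn by (simp add: N_def d_def)
  have N1: "N $$ (i, l) = (if l < d then companion f $$ (i, l) else 0)" if "i < d" "l < n" for i l
    using that dn B by (auto simp: N_def companion_def d_def)
  have N2: "N $$ (i, l) = (if l < d then 0 else T $$ (i, l))" if "d \<le> i" "i < n" "l < n" for i l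
    using that dn B by (auto simp: N_def companion_def d_def B_def)
  \<comment> \<open>Row \<open>i + 1\<close> of \<open>G\<close> is row \<open>i\<close> times \<open>T\<close>, and after row
      \<open>d - 1\<close> the relation \<open>\<rho>_d\<close> closes up the companion block.\<close>
  have "G * T = N * G"
  proof (rule eq_matI)
    fix i j assume "i < dim_row (N * G)" "j < dim_col (N * G)"
    then have ij: "i < n" "j < n" using N G by auto
    have l: "(G * T) $$ (i, j) = (\<Sum>l<n. G $$ (i, l) * T $$ (l, j))"
      using ij G T by (auto simp: scalar_prod_def lessThan_atLeast0 intro!: sum.cong)
    have r: "(N * G) $$ (i, j) = (\<Sum>l<n. N $$ (i, l) * G $$ (l, j))"
      using ij G N by (auto simp: scalar_prod_def lessThan_atLeast0 intro!: sum.cong)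
    show "(G * T) $$ (i, j) = (N * G) $$ (i, j)"
    proof (cases "i < d")
      case True
      have "(G * T) $$ (i, j) = \<rho> (Suc i) j"
        unfolding l \<rho>_Suc[OF ij(2)] using True ij by (intro sum.cong) (auto simp: G_def)
      moreover have "(N * G) $$ (i, j) = (\<Sum>l<d. companion f $$ (i, l) * \<rho> l j)"
      proof -
        have "(N * G) $$ (i, j) = (\<Sum>l<d. N $$ (i, l) * G $$ (l, j))"
          unfolding r using N1[OF True] dn by (intro sum.mono_neutral_right) auto
        also have "\<dots> = (\<Sum>l<d. companion f $$ (i, l) * \<rho> l j)"
          using N1[OF True] dn ij by (intro sum.cong) (auto simp: G_def)
        finally show ?thesis .
      qed
      moreover have "(\<Sum>l<d. companion f $$ (i, l) * \<rho> l j) = \<rho> (Suc i) j"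
      proof (cases "Suc i < d")
        case True
        have "(\<Sum>l<d. companion f $$ (i, l) * \<rho> l j) = (\<Sum>l<d. if l = Suc i then \<rho> l j else 0)"
          using True by (intro sum.cong) (auto simp: companion_def d_def)
        then show ?thesis using True by simp
      next
        case False
        then have "Suc i = d" using \<open>i < d\<close> by simp
        then show ?thesis using \<rho>_d[OF ij(2)] by (auto simp: companion_def d_def intro!: sum.cong)
      qed
      ultimately show ?thesis by simp
    next
      case False
      have "(G * T) $$ (i, j) = (\<Sum>l<n. if l = i then T $$ (l, j) else 0)"
        unfolding l using False ij by (intro sum.cong) (auto simp: G_def)
      then have l': "(G * T) $$ (i, j) = T $$ (i, j)" using ij by simp
      have "(N * G) $$ (i, j) = (\<Sum>l<n. if l = j then (if j < d then 0 else T $$ (i, l)) else 0)"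
        unfolding r using False ij N2[of i] by (intro sum.cong) (auto simp: G_def)
      then show ?thesis unfolding l' using T_low[of i j] False ij by auto
    qed
  qed (use G T N in auto)
  then have "H * N * G = H * (G * T)" using H N G by (simp add: assoc_mult_mat[of _ n n _ n _ n])
  also have "\<dots> = T" using H G T GH by (simp flip: assoc_mult_mat[of _ n n _ n _ n])
  finally have "similar_mat T N" using H G T N GH by (intro similar_matI[of _ _ H G n]) auto
  then have "similar_mat A N" using similar_mat_trans[OF AT] by blast
  then show thesis using that[of f B] f(1) d0 dn B pf unfolding N_def d_def by blast
qed

section \<open>The anticommuting square root on a companion block\<close>

lemma poly_mat_sum_index:
  assumes A: "A \<in> carrier_mat n n" and ij: "i < n" "j < n"
  shows "poly_mat A (\<Sum>k\<in>I. p k) $$ (i, j) = (\<Sum>k\<in>I. poly_mat A (p k) $$ (i, j))"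
proof (induct I rule: infinite_finite_induct)
  case (insert k I)
  then show ?case using A ij by (simp add: poly_mat_add[OF A])
qed (use A ij in \<open>auto simp: poly_mat_0\<close>)

lemma row0_mult_cong:
  assumes "U \<in> carrier_mat d d" "V \<in> carrier_mat d d" "Z \<in> carrier_mat d d"
    and "\<And>l. l < d \<Longrightarrow> U $$ (0, l) = V $$ (0, l)" and "j < d"
  shows "(U * Z) $$ (0, j) = ((V * Z) $$ (0, j) :: 'a::field)"
  using assms by (auto simp: scalar_prod_def intro!: sum.cong)

text \<open>
  Identify a row vector of length \<open>d\<close> with a polynomial modulo \<open>f\<close>, where row \<open>0\<close> of \<open>g(M)\<close>
  corresponds to \<open>g\<close> and \<open>M = companion f\<close> acts from the right as multiplication by \<open>X\<close>. Then \<open>S\<close> is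
  the map \<open>g \<mapsto> w(X) g(-X)\<close>. The assumption that \<open>w(X) f(-X)\<close> annihilates \<open>M\<close> makes it well defined
  modulo \<open>f\<close>; anticommutation and the formula for the square are read off from the map.
\<close>

lemma companion_anticommuting:
  fixes f w :: "'a::field poly"
  assumes d0: "0 < degree f" and pf: "poly_mat (companion f) f = 0\<^sub>m (degree f) (degree f)"
    and pw: "poly_mat (companion f) (w * reflect f) = 0\<^sub>m (degree f) (degree f)"
  shows "\<exists>S\<in>carrier_mat (degree f) (degree f). S * companion f = - (companion f * S)
    \<and> S * S = poly_mat (companion f) (w * reflect w)"
proof -
  define d where "d = degree f"
  define M where "M = companion f"
  have M: "M \<in> carrier_mat d d" by (simp add: M_def d_def)
  have pM: "poly_mat M g \<in> carrier_mat d d" for g using M by auto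
  have row0: "poly_mat M g $$ (0, j) = coeff g j" if "degree g < d" "j < d" for g j
    using that poly_mat_companion_row0 unfolding M_def d_def by blast
  define x where "x = (\<lambda>i. monom 1 i :: 'a poly)"
  have rx: "reflect (monom c i) = smult c ([:0, -1:] ^ i)" for c :: 'a and i
    by (simp add: monom_altdef pcompose_smult pcompose_power pcompose_pCons)
  define S where "S = mat d d (\<lambda>(i, j). poly_mat M (w * reflect (x i)) $$ (0, j))"
  have S: "S \<in> carrier_mat d d" by (simp add: S_def)
  have row_i: "(poly_mat M (x i) * Z) $$ (0, j) = Z $$ (i, j)" if "i < d" "j < d" "Z \<in> carrier_mat d d" for i j Z
  proof -
    have "(poly_mat M (x i) * Z) $$ (0, j) = (\<Sum>l<d. poly_mat M (x i) $$ (0, l) * Z $$ (l, j))"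
      using that pM M by (auto simp: scalar_prod_def lessThan_atLeast0 intro!: sum.cong)
    also have "\<dots> = (\<Sum>l<d. if l = i then Z $$ (l, j) else 0)"
      using that by (intro sum.cong) (auto simp: row0 x_def degree_monom_eq)
    finally show ?thesis using that by simp
  qed
  \<comment> \<open>\<open>S\<close> acts on row vectors as \<open>g \<mapsto> w(X) g(-X)\<close>: by linearity in degrees below
      \<open>d\<close>, then in general by division by \<open>f\<close>.\<close>
  have low: "(poly_mat M g * S) $$ (0, j) = poly_mat M (w * reflect g) $$ (0, j)"
    if g: "degree g < d" and j: "j < d" for g j
  proof -
    have "g = (\<Sum>i\<le>d - 1. monom (coeff g i) i)"
      using g by (intro poly_as_sum_of_monoms'[symmetric]) auto
    also have "reflect \<dots> = (\<Sum>i\<le>d - 1. smult (coeff g i) (reflect (x i)))"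
      unfolding pcompose_sum x_def by (simp add: rx)
    finally have "w * reflect g = (\<Sum>i\<le>d - 1. smult (coeff g i) (w * reflect (x i)))"
      by (simp add: sum_distrib_left)
    then have "poly_mat M (w * reflect g) $$ (0, j)
      = (\<Sum>i\<le>d - 1. coeff g i * poly_mat M (w * reflect (x i)) $$ (0, j))"
      using M j pM by (simp add: poly_mat_sum_index[OF M] poly_mat_smult[OF M])
    also have "\<dots> = (\<Sum>i<d. poly_mat M g $$ (0, i) * S $$ (i, j))"
      using j g by (intro sum.cong) (auto simp: S_def row0)
    also have "\<dots> = (poly_mat M g * S) $$ (0, j)"
      using j pM S M by (auto simp: scalar_prod_def lessThan_atLeast0 intro!: sum.cong)
    finally show ?thesis by simp
  qed
  have key: "(poly_mat M g * S) $$ (0, j) = poly_mat M (w * reflect g) $$ (0, j)" if j: "j < d" for g j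
  proof -
    have fM: "poly_mat M f = 0\<^sub>m d d" "poly_mat M (w * reflect f) = 0\<^sub>m d d"
      using pf pw by (simp_all add: M_def d_def)
    have "poly_mat M (g div f * f + g mod f) = poly_mat M (g mod f)"
      unfolding poly_mat_add[OF M] poly_mat_mult[OF M] fM
        right_mult_zero_mat[OF pM] left_add_zero_mat[OF pM] ..
    then have "poly_mat M g = poly_mat M (g mod f)" unfolding div_mult_mod_eq .
    moreover have "w * reflect (q * f + r) = reflect q * (w * reflect f) + w * reflect r" for q r
      unfolding pcompose_add pcompose_mult by (simp add: algebra_simps)
    then have "poly_mat M (w * reflect (q * f + r)) = poly_mat M (w * reflect r)" for q r
      unfolding poly_mat_add[OF M] poly_mat_mult[OF M, of "reflect q"] fM
        right_mult_zero_mat[OF pM] left_add_zero_mat[OF pM] by (simp only: poly_mat_add[OF M]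
        poly_mat_mult[OF M, of "reflect q"] fM right_mult_zero_mat[OF pM] left_add_zero_mat[OF pM])
    then have "poly_mat M (w * reflect g) = poly_mat M (w * reflect (g mod f))"
      by (metis div_mult_mod_eq)
    moreover have "degree (g mod f) < d"
    proof -
      have "f \<noteq> 0" using d0 by auto
      from degree_mod_less[OF this, of g] show ?thesis using d0 unfolding d_def by (elim disjE) simp_all
    qed
    note low[OF this j]
    ultimately show ?thesis by (simp only:)
  qed
  note as = assoc_mult_mat[of _ d d _ d _ d]
  \<comment> \<open>Matrices are compared row by row, and row \<open>i\<close> of \<open>Z\<close> is row \<open>0\<close> of
      \<open>M\<^sup>i Z\<close>.\<close>
  have SM: "(S * M) $$ (i, j) = poly_mat M (w * reflect (x i) * [:0, 1:]) $$ (0, j)" if "i < d" "j < d" for i j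
  proof -
    have "(S * M) $$ (i, j) = (poly_mat M (x i) * S * M) $$ (0, j)"
      using row_i[OF that, of "S * M"] S M pM by (simp add: as)
    also have "\<dots> = (poly_mat M (w * reflect (x i)) * M) $$ (0, j)"
      by (rule row0_mult_cong[of _ d]) (use key that S M pM in \<open>auto intro!: mult_carrier_mat\<close>)
    finally show ?thesis by (simp only: poly_mat_mult[OF M, of _ "[:0, 1:]"] poly_mat_X[OF M])
  qed
  have MS: "(M * S) $$ (i, j) = poly_mat M (w * reflect (x i) * [:0, -1:]) $$ (0, j)" if "i < d" "j < d" for i j
  proof -
    have "(M * S) $$ (i, j) = (poly_mat M (x i) * M * S) $$ (0, j)"
      using row_i[OF that, of "M * S"] S M pM by (simp add: as)
    also have "poly_mat M (x i) * M = poly_mat M (x i * [:0, 1:])"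
      by (simp only: poly_mat_mult[OF M, of _ "[:0, 1:]"] poly_mat_X[OF M])
    also have "(\<dots> * S) $$ (0, j) = poly_mat M (w * reflect (x i * [:0, 1:])) $$ (0, j)"
      by (rule key[OF that(2)])
    also have "w * reflect (x i * [:0, 1:]) = w * reflect (x i) * [:0, -1:]"
      by (simp only: pcompose_mult mult.assoc) (simp add: pcompose_pCons)
    finally show ?thesis .
  qed
  have SS: "(S * S) $$ (i, j) = poly_mat M (w * reflect w) $$ (i, j)" if "i < d" "j < d" for i j
  proof -
    have "(S * S) $$ (i, j) = (poly_mat M (x i) * S * S) $$ (0, j)"
      using row_i[OF that, of "S * S"] S M pM by (simp add: as)
    also have "\<dots> = (poly_mat M (w * reflect (x i)) * S) $$ (0, j)"
      by (rule row0_mult_cong[of _ d]) (use key that S M pM in \<open>auto intro!: mult_carrier_mat\<close>)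
    also have "\<dots> = poly_mat M (w * reflect (w * reflect (x i))) $$ (0, j)" by (rule key[OF that(2)])
    also have "w * reflect (w * reflect (x i)) = x i * (w * reflect w)"
      by (simp only: pcompose_mult reflect_reflect mult_ac)
    also have "poly_mat M \<dots> $$ (0, j) = poly_mat M (w * reflect w) $$ (i, j)"
      unfolding poly_mat_mult[OF M, of "x i"] using that pM by (intro row_i) auto
    finally show ?thesis .
  qed
  have "S * M = - (M * S)"
  proof (rule eq_matI)
    fix i j assume "i < dim_row (- (M * S))" "j < dim_col (- (M * S))"
    then have ij: "i < d" "j < d" using M S by auto
    have neg: "w * reflect (x i) * [:0, -1:] = - (w * reflect (x i) * [:0, 1:])"
      by (simp flip: mult_minus_right)
    have "(M * S) $$ (i, j) = - ((S * M) $$ (i, j))"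
      unfolding MS[OF ij] SM[OF ij] neg poly_mat_uminus[OF M]
      using ij poly_mat_dim[OF M] by (intro index_uminus_mat) simp_all
    moreover have "(- (M * S)) $$ (i, j) = - ((M * S) $$ (i, j))"
      by (rule index_uminus_mat) (use ij M S in simp_all)
    ultimately show "(S * M) $$ (i, j) = (- (M * S)) $$ (i, j)" by (simp only: minus_minus)
  qed (use M S in simp_all)
  moreover have "S * S = poly_mat M (w * reflect w)"
  proof (rule eq_matI)
    fix i j assume "i < dim_row (poly_mat M (w * reflect w))" "j < dim_col (poly_mat M (w * reflect w))"
    then have "i < d" "j < d" by (simp_all add: poly_mat_dim[OF M])
    then show "(S * S) $$ (i, j) = poly_mat M (w * reflect w) $$ (i, j)" by (rule SS)
  qed (use M S pM in simp_all)
  ultimately show ?thesis using S unfolding M_def d_def by blast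
qed

section \<open>Divisibility and orders of roots\<close>

text \<open>
  Divide out a common root and continue by induction on the degree.
\<close>

lemma alg_closed_dvdI:
  fixes p q :: "'a::alg_closed_field poly"
  assumes "p \<noteq> 0" "q \<noteq> 0" "\<And>e. order e p \<le> order e q"
  shows "p dvd q"
  using assms
proof (induct "degree p" arbitrary: p q rule: less_induct)
  case less
  show ?case
  proof (cases "degree p = 0")
    case True
    then show ?thesis using less(2) by (meson is_unit_iff_degree one_dvd dvd_trans)
  next
    case False
    then obtain e where e: "poly p e = 0" using alg_closed_imp_poly_has_root[of p] by auto
    then obtain p' where p': "p = [:- e, 1:] * p'" unfolding poly_eq_0_iff_dvd by (rule dvdE)
    have "order e p \<noteq> 0" using e less(2) by (simp add: order_root)
    then have "poly q e = 0" using less(4)[of e] less(3) by (simp add: order_root)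
    then obtain q' where q': "q = [:- e, 1:] * q'" unfolding poly_eq_0_iff_dvd by (rule dvdE)
    have nz: "p' \<noteq> 0" "q' \<noteq> 0" using less(2,3) p' q' by auto
    have "order c p' \<le> order c q'" for c
      using less(4)[of c] less(2,3) order_mult[of "[:- e, 1:]" p' c] order_mult[of "[:- e, 1:]" q' c]
      unfolding p' q' by linarith
    moreover have "degree p' < degree p" using degree_mult_eq[of "[:- e, 1:]" p'] nz(1) unfolding p' by auto
    ultimately have "p' dvd q'" using nz less(1) by blast
    then show ?thesis unfolding p' q' by (rule mult_dvd_mono[OF dvd_refl])
  qed
qed

text \<open>
  One inequality suffices, since \<open>reflect\<close> is an involution.
\<close>

lemma order_reflect:
  fixes p :: "'a::field poly"
  assumes "p \<noteq> 0"
  shows "order e (reflect p) = order (- e) p"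
proof -
  have le: "order (- c) q \<le> order c (reflect q)" if "q \<noteq> 0" for q :: "'a poly" and c
  proof -
    have r0: "reflect q \<noteq> 0" using that reflect_reflect[of q] by auto
    obtain k where "q = [:- (- c), 1:] ^ order (- c) q * k" using order_1[of "- c" q] by (rule dvdE)
    then have "reflect q = reflect ([:- (- c), 1:] ^ order (- c) q * k)" by simp
    also have "\<dots> = (- [:- c, 1:]) ^ order (- c) q * reflect k"
      by (simp add: pcompose_mult pcompose_power pcompose_pCons)
    also have "\<dots> = [:- c, 1:] ^ order (- c) q * smult ((-1) ^ order (- c) q) (reflect k)"
      unfolding uminus_power_smult by simp
    finally have "[:- c, 1:] ^ order (- c) q dvd reflect q" by (metis dvd_triv_left)
    then show ?thesis using r0 by (simp add: order_divides)
  qed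
  have "reflect p \<noteq> 0" using assms reflect_reflect[of p] by auto
  from le[OF this, of "- e"] le[OF assms, of e] show ?thesis by (simp add: reflect_reflect)
qed

section \<open>Counting Jordan blocks through nullities\<close>

text \<open>
  The number of Jordan blocks of \<open>e\<close> of size greater than \<open>k\<close>, that is \<open>n\<^sub>k\<^sub>+\<^sub>1(A, e)\<close>; the indices start
  at \<open>0\<close>.
\<close>

definition nullity_step :: "'a::field mat \<Rightarrow> 'a \<Rightarrow> nat \<Rightarrow> nat" where
  "nullity_step A e k = nullity A ([:- e, 1:] ^ Suc k) - nullity A ([:- e, 1:] ^ k)"

lemma nullity_power_Suc:
  "A \<in> carrier_mat n n \<Longrightarrow> nullity A ([:- e, 1:] ^ Suc k) = nullity A ([:- e, 1:] ^ k) + nullity_step A e k"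
  using nullity_mono[of A n "[:- e, 1:] ^ k" "[:- e, 1:]"] unfolding nullity_step_def power_Suc by linarith

text \<open>
  If \<open>f = (X - e)\<^sup>m g\<close> with \<open>g(e) \<noteq> 0\<close>, then for \<open>j \<ge> m\<close> the nullities of \<open>(X - e)\<^sup>j\<close> and \<open>g\<close> add up to
  \<open>n\<close>, so the former does not depend on \<open>j\<close>.
\<close>

lemma nullity_step_beyond_order:
  fixes A :: "'a::field mat"
  assumes A: "A \<in> carrier_mat n n" and f: "poly_mat A f = 0\<^sub>m n n" "f \<noteq> 0" and k: "order e f \<le> k"
  shows "nullity_step A e k = 0"
proof -
  obtain g where g: "f = [:- e, 1:] ^ order e f * g" "\<not> [:- e, 1:] dvd g"
    using order_decomp[OF f(2), of e] by blast
  then have ge: "poly g e \<noteq> 0" by (simp add: poly_eq_0_iff_dvd)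
  have "nullity A ([:- e, 1:] ^ j) + nullity A g = n" if "order e f \<le> j" for j
  proof -
    have e: "[:- e, 1:] ^ j * g = [:- e, 1:] ^ (j - order e f) * f"
      using that by (subst (2) g(1)) (simp flip: power_add mult.assoc)
    have "poly_mat A ([:- e, 1:] ^ j * g) = 0\<^sub>m n n"
      unfolding e poly_mat_mult[OF A] f(1) by (rule right_mult_zero_mat) (use A in auto)
    then have "nullity A ([:- e, 1:] ^ j * g) = n" by (simp add: nullity_def kernel_dim_0)
    then show ?thesis using nullity_linear_coprime[OF A ge] by simp
  qed
  from this[of k] this[of "Suc k"] k show ?thesis unfolding nullity_step_def by simp
qed

text \<open>
  A kernel vector is determined by its first entry: the relation in row \<open>i\<close> expresses entry \<open>i + 1\<close>
  through entry \<open>i\<close>.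
\<close>

lemma nullity_companion_linear:
  fixes f :: "'a::field poly"
  assumes "0 < degree f"
  shows "nullity (companion f) [:- e, 1:] \<le> 1"
  unfolding nullity_def
proof (rule kernel_dim_le_1)
  let ?d = "degree f" and ?M = "companion f"
  show M: "poly_mat ?M [:- e, 1:] \<in> carrier_mat ?d ?d" by auto
  show "vec ?d (\<lambda>i. e ^ i) \<in> carrier_vec ?d" by simp
  fix x assume "x \<in> mat_kernel (poly_mat ?M [:- e, 1:])"
  then have x: "x \<in> carrier_vec ?d" "poly_mat ?M [:- e, 1:] *\<^sub>v x = 0\<^sub>v ?d"
    using mat_kernelD[OF M] by auto
  have step: "x $ Suc i = e * x $ i" if i: "Suc i < ?d" for i
  proof -
    have "0 = (poly_mat ?M [:- e, 1:] *\<^sub>v x) $ i" using x(2) i by simp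
    also have "\<dots> = (\<Sum>l<?d. (?M $$ (i, l) + - e * (if i = l then 1 else 0)) * x $ l)"
      using i x(1) unfolding poly_mat_char_matrix[OF companion_carrier] char_matrix_def
      by (auto simp: scalar_prod_def lessThan_atLeast0 companion_def intro!: sum.cong)
    also have "\<dots> = (\<Sum>l<?d. (if l = Suc i then x $ l else 0) + (if l = i then - e * x $ l else 0))"
      using i by (intro sum.cong) (auto simp: companion_def)
    also have "\<dots> = x $ Suc i - e * x $ i" using i by (simp add: sum.distrib)
    finally show ?thesis by simp
  qed
  have geom: "x $ i = x $ 0 * e ^ i" if "i < ?d" for i
    using that by (induct i) (auto simp: step)
  have "x = x $ 0 \<cdot>\<^sub>v vec ?d (\<lambda>i. e ^ i)"
  proof (rule eq_vecI)
    fix i assume "i < dim_vec (x $ 0 \<cdot>\<^sub>v vec ?d (\<lambda>i. e ^ i))"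
    then have i: "i < ?d" by simp
    show "x $ i = (x $ 0 \<cdot>\<^sub>v vec ?d (\<lambda>i. e ^ i)) $ i" by (subst geom[OF i]) (simp add: i)
  qed (use x(1) in simp)
  then show "\<exists>c. x = c \<cdot>\<^sub>v vec ?d (\<lambda>i. e ^ i)" by blast
qed

text \<open>
  A companion matrix has exactly one Jordan block for each root \<open>e\<close> of \<open>f\<close>, of size \<open>order e f\<close>. There
  is at most one by \<open>nullity_companion_linear\<close> and concavity. If the kernels of \<open>(X - e)\<^sup>k\<close> stopped
  growing before \<open>k\<close> reaches the order, a proper divisor of \<open>f\<close> would annihilate the matrix.
\<close>

lemma nullity_step_companion:
  fixes f :: "'a::field poly"
  assumes d0: "0 < degree f" and pf: "poly_mat (companion f) f = 0\<^sub>m (degree f) (degree f)"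
  shows "nullity_step (companion f) e k = (if k < order e f then 1 else 0)"
proof (cases "k < order e f")
  case False
  have "f \<noteq> 0" using d0 by auto
  from nullity_step_beyond_order[OF companion_carrier pf this] False show ?thesis by simp
next
  case True
  let ?M = "companion f" and ?N = "[:- e, 1:]"
  note M = companion_carrier[of f]
  have f0: "f \<noteq> 0" using d0 by auto
  have "nullity ?M (?N * 1 * ?N ^ k) + nullity ?M 1 \<le> nullity ?M (1 * ?N ^ k) + nullity ?M (?N * 1)"
    by (rule nullity_frobenius[OF M])
  then have le: "nullity_step ?M e k \<le> 1"
    using nullity_companion_linear[OF d0, of e] unfolding nullity_step_def power_Suc mult_1_left mult_1_right
    by linarith
  have "nullity_step ?M e k \<noteq> 0"
  proof
    assume 0: "nullity_step ?M e k = 0"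
    obtain g where g: "f = ?N ^ order e f * g" using order_1[of e f] by (rule dvdE)
    have *: "nullity ?M (?N ^ (j + k) * g) \<le> nullity ?M (?N ^ k * g)" for j
    proof (induct j)
      case (Suc j)
      have e: "?N * ?N ^ k * (?N ^ j * g) = ?N ^ (Suc j + k) * g" "?N ^ k * (?N ^ j * g) = ?N ^ (j + k) * g"
        by (simp_all only: power_add power_Suc mult_ac)
      have "nullity ?M (?N * ?N ^ k * (?N ^ j * g)) + nullity ?M (?N ^ k) \<le> nullity ?M (?N ^ k * (?N ^ j * g)) + nullity ?M (?N * ?N ^ k)"
        by (rule nullity_frobenius[OF M])
      moreover have "nullity ?M (?N * ?N ^ k) = nullity ?M (?N ^ k)"
        using nullity_power_Suc[OF M, of e k] 0 unfolding power_Suc by linarith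
      ultimately show ?case using Suc unfolding e by linarith
    qed (simp only: add_0 order.refl)
    have "?N ^ (order e f - k + k) * g = f" using True g by (simp only: le_add_diff_inverse2 less_imp_le)
    with *[of "order e f - k"] have "nullity ?M f \<le> nullity ?M (?N ^ k * g)" by (simp only:)
    moreover have "nullity ?M f = degree f" using kernel_dim_0 by (simp add: nullity_def pf)
    moreover have "nullity ?M (?N ^ k * g) \<le> degree f"
      using nullity_mono[OF M, of "?N ^ k * g" 0] nullity_0[OF M] by simp
    ultimately have "poly_mat ?M (?N ^ k * g) = 0\<^sub>m (degree f) (degree f)"
      by (intro nullity_full_imp_0[OF M]) simp
    moreover have g0: "g \<noteq> 0" using f0 g by auto
    have dN: "degree (?N ^ i * g) = i + degree g" for i
      using g0 by (subst degree_mult_eq) (simp_all add: degree_power_eq)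
    have "degree (?N ^ k * g) < degree f"
      using True dN[of k] dN[of "order e f"] g[symmetric] by (simp only:)
    ultimately have "?N ^ k * g = 0" by (rule companion_annihilator_degree)
    moreover have "?N ^ k \<noteq> 0" by (rule power_not_zero) simp
    ultimately show False using g0 by (metis mult_eq_0_iff)
  qed
  then show ?thesis using le True by simp
qed

section \<open>Construction over the ground field\<close>

interpretation to_ac_hom: inj_idom_hom "to_ac :: 'a::field \<Rightarrow> 'a alg_closure"
  by unfold_locales auto

interpretation to_ac_poly_hom: map_poly_inj_idom_hom "to_ac :: 'a::field \<Rightarrow> 'a alg_closure" ..

lemma similar_mat_ac:
  fixes A :: "'a::field mat"
  assumes A: "A \<in> carrier_mat n n" and s: "similar_mat A B"
  shows "similar_mat (mat_ac A) (mat_ac B)"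
proof -
  from similar_matD[OF s] A obtain P Q where
    c: "{A, B, P, Q} \<subseteq> carrier_mat n n" and e: "P * Q = 1\<^sub>m n" "Q * P = 1\<^sub>m n" "A = P * B * Q"
    by (metis carrier_matD(1) insert_subset)
  then have P: "P \<in> carrier_mat n n" and Q: "Q \<in> carrier_mat n n" and B: "B \<in> carrier_mat n n" by auto
  have "mat_ac P * mat_ac Q = 1\<^sub>m n" "mat_ac Q * mat_ac P = 1\<^sub>m n"
    unfolding mat_ac_def to_ac_hom.mat_hom_mult[OF P Q, symmetric] to_ac_hom.mat_hom_mult[OF Q P, symmetric] e(1,2)
    by (auto simp: to_ac_hom.mat_hom_one)
  moreover have "mat_ac A = mat_ac P * mat_ac B * mat_ac Q"
    unfolding e(3) mat_ac_def to_ac_hom.mat_hom_mult[OF mult_carrier_mat[OF P B] Q] to_ac_hom.mat_hom_mult[OF P B] ..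
  ultimately show ?thesis
    by (intro similar_matI[of _ _ "mat_ac P" "mat_ac Q" n]) (use c in \<open>auto simp: mat_ac_def\<close>)
qed

lemma nullity_step_four_block:
  assumes A: "A \<in> carrier_mat n n" and B: "B \<in> carrier_mat m m"
  shows "nullity_step (four_block_mat A (0\<^sub>m n m) (0\<^sub>m m n) B) e k = nullity_step A e k + nullity_step B e k"
proof -
  have F: "four_block_mat A (0\<^sub>m n m) (0\<^sub>m m n) B \<in> carrier_mat (n + m) (n + m)" using A B by auto
  show ?thesis
    using nullity_power_Suc[OF F, of e k] nullity_power_Suc[OF A, of e k] nullity_power_Suc[OF B, of e k]
    unfolding nullity_four_block[OF A B] by linarith
qed

lemma nullity_step_similar:
  assumes "A \<in> carrier_mat n n" "similar_mat A B"
  shows "nullity_step A e k = nullity_step B e k"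
  unfolding nullity_step_def nullity_similar[OF assms] ..

lemma anticommuting_similar:
  fixes A :: "'a::field mat"
  assumes s: "similar_mat A N" and A: "A \<in> carrier_mat n n" and U: "U \<in> carrier_mat n n"
    and UN: "U * N = - (N * U)" "U * U = poly_mat N g"
  shows "\<exists>S\<in>carrier_mat n n. S * A = - (A * S) \<and> S * S = poly_mat A g"
proof -
  from similar_matD[OF s] A obtain P Q where
    c: "{A, N, P, Q} \<subseteq> carrier_mat n n" and e: "P * Q = 1\<^sub>m n" "Q * P = 1\<^sub>m n" "A = P * N * Q"
    by (metis carrier_matD(1) insert_subset)
  then have P: "P \<in> carrier_mat n n" and Q: "Q \<in> carrier_mat n n" and N: "N \<in> carrier_mat n n" by auto
  note as = assoc_mult_mat[of _ n n _ n _ n]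
  define S where "S = P * U * Q"
  have S: "S \<in> carrier_mat n n" using P Q U by (auto simp: S_def)
  have conj: "(P * Y * Q) * (P * Z * Q) = P * (Y * Z) * Q"
    if "Y \<in> carrier_mat n n" "Z \<in> carrier_mat n n" for Y Z
  proof -
    have "(P * Y * Q) * (P * Z * Q) = P * Y * (Q * P) * Z * Q" using that P Q by (simp add: as)
    also have "\<dots> = P * (Y * Z) * Q" unfolding e(2) using that P Q by (simp add: as)
    finally show ?thesis .
  qed
  have gN: "poly_mat N g \<in> carrier_mat n n" using N by auto
  have "S * A = P * (U * N) * Q" unfolding S_def e(3) by (rule conj[OF U N])
  also have "\<dots> = - (P * (N * U) * Q)"
    unfolding UN using P N U Q mult_carrier_mat[OF N U] mult_carrier_mat[OF P mult_carrier_mat[OF N U]] by simp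
  also have "P * (N * U) * Q = A * S" unfolding S_def e(3) by (rule conj[OF N U, symmetric])
  finally have 1: "S * A = - (A * S)" .
  have AP: "A * P = P * N"
  proof -
    have "A * P = P * N * (Q * P)" unfolding e(3) using P N Q by (simp add: as)
    then show ?thesis unfolding e(2) using P N by simp
  qed
  have "S * S = P * poly_mat N g * Q" unfolding S_def conj[OF U U] UN(2) ..
  also have "\<dots> = poly_mat A g * (P * Q)"
    unfolding poly_mat_intertwine[OF A N P AP, symmetric] by (rule as) (use A P Q in auto)
  also have "\<dots> = poly_mat A g" unfolding e(1) by (rule right_mult_one_mat[OF poly_mat_carrier[OF A]])
  finally show ?thesis using S 1 by blast
qed

lemma anticommuting_four_block:
  fixes M :: "'a::field mat"
  assumes M: "M \<in> carrier_mat d d" and B: "B \<in> carrier_mat m m"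
    and S1: "S1 \<in> carrier_mat d d" "S1 * M = - (M * S1)" "S1 * S1 = poly_mat M g"
    and S2: "S2 \<in> carrier_mat m m" "S2 * B = - (B * S2)" "S2 * S2 = poly_mat B g"
  defines "D \<equiv> \<lambda>A B. four_block_mat A (0\<^sub>m d m) (0\<^sub>m m d) B"
  shows "D S1 S2 * D M B = - (D M B * D S1 S2)" "D S1 S2 * D S1 S2 = poly_mat (D M B) g"
proof -
  have mult: "D Y1 Y2 * D Z1 Z2 = D (Y1 * Z1) (Y2 * Z2)"
    if "Y1 \<in> carrier_mat d d" "Y2 \<in> carrier_mat m m" "Z1 \<in> carrier_mat d d" "Z2 \<in> carrier_mat m m" for Y1 Y2 Z1 Z2
    unfolding D_def using that
    by (subst mult_four_block_mat[of _ d d _ m _ m _ _ d _ m]) (auto simp: mult_carrier_mat[of _ d d _ d] mult_carrier_mat[of _ m m _ m])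
  have neg: "D (- Y) (- Z) = - D Y Z" if "Y \<in> carrier_mat d d" "Z \<in> carrier_mat m m" for Y Z
    unfolding D_def using that by (intro eq_matI) auto
  show "D S1 S2 * D M B = - (D M B * D S1 S2)"
    unfolding mult[OF S1(1) S2(1) M B] mult[OF M B S1(1) S2(1)] S1(2) S2(2)
    by (rule neg[OF mult_carrier_mat[OF M S1(1)] mult_carrier_mat[OF B S2(1)]])
  show "D S1 S2 * D S1 S2 = poly_mat (D M B) g"
    unfolding mult[OF S1(1) S2(1) S1(1) S2(1)] S1(3) S2(3) unfolding D_def poly_mat_four_block[OF M B] ..
qed

lemma map_poly_to_ac_reflect: "map_poly to_ac (reflect p) = reflect (map_poly to_ac p)"
  by (simp add: to_ac_hom.map_poly_pcompose)

text \<open>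
  The hypotheses are the two conditions of the theorem in terms of \<open>nullity_step\<close>. They pass to the
  complement \<open>B\<close> of the companion block because its step numbers are those of \<open>A\<close> minus one,
  truncated at \<open>0\<close>. For \<open>k = order \<mu> f\<close> they bound the orders of \<open>f\<close> at \<open>\<mu>\<close> and \<open>-\<mu>\<close> by each other.
\<close>

lemma ex_anticommuting:
  fixes A :: "'a::field mat" and a :: 'a
  assumes "A \<in> carrier_mat n n"
    and "\<And>k. nullity_step (mat_ac A) (to_ac a) (Suc k) \<le> nullity_step (mat_ac A) (- to_ac a) k"
    and "\<And>k. nullity_step (mat_ac A) (- to_ac a) (Suc k) \<le> nullity_step (mat_ac A) (to_ac a) k"
    and "\<And>e k. e \<noteq> to_ac a \<Longrightarrow> e \<noteq> - to_ac a \<Longrightarrow> nullity_step (mat_ac A) e k = nullity_step (mat_ac A) (- e) k"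
  shows "\<exists>S\<in>carrier_mat n n. S * A = - (A * S) \<and> S * S = poly_mat A [:a\<^sup>2, 0, -1:]"
  using assms
proof (induct n arbitrary: A rule: less_induct)
  case (less n)
  note A = less(2)
  show ?case
  proof (cases "n = 0")
    case True
    then show ?thesis using A by (intro bexI[of _ A] conjI eq_matI) auto
  next
    case False
    then obtain f B where f: "monic f" "0 < degree f" "degree f \<le> n"
      and B: "B \<in> carrier_mat (n - degree f) (n - degree f)"
      and sim: "similar_mat A (four_block_mat (companion f) (0\<^sub>m (degree f) (n - degree f)) (0\<^sub>m (n - degree f) (degree f)) B)"
      and pf: "poly_mat A f = 0\<^sub>m n n"
      using companion_splitting[OF A] by blast
    define d where "d = degree f"
    define M where "M = companion f"
    define N where "N = four_block_mat M (0\<^sub>m d (n - d)) (0\<^sub>m (n - d) d) B"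
    have M: "M \<in> carrier_mat d d" and B: "B \<in> carrier_mat (n - d) (n - d)" using B by (auto simp: M_def d_def)
    have AN: "similar_mat A N" using sim by (simp add: N_def M_def d_def)
    have dn: "d \<le> n" "n - d < n" using f by (auto simp: d_def)
    have pM: "poly_mat M f = 0\<^sub>m d d" and pB: "poly_mat B f = 0\<^sub>m (n - d) (n - d)"
    proof -
      have "nullity A f = n" unfolding nullity_def pf by (rule kernel_dim_0)
      then have "nullity M f + nullity B f = n"
        unfolding nullity_similar[OF A AN] N_def nullity_four_block[OF M B] .
      moreover have "nullity M f \<le> d" using nullity_mono[OF M, of f 0] nullity_0[OF M] by simp
      moreover have "nullity B f \<le> n - d" using nullity_mono[OF B, of f 0] nullity_0[OF B] by simp
      ultimately have "nullity M f = d" "nullity B f = n - d" using dn by linarith+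
      then show "poly_mat M f = 0\<^sub>m d d" "poly_mat B f = 0\<^sub>m (n - d) (n - d)"
        using nullity_full_imp_0 M B by blast+
    qed
    let ?A = "mat_ac A" and ?M = "mat_ac M" and ?B = "mat_ac B" and ?f = "map_poly to_ac f"
    let ?a = "to_ac a"
    have A': "?A \<in> carrier_mat n n" and M': "?M \<in> carrier_mat d d" and B': "?B \<in> carrier_mat (n - d) (n - d)"
      using A M B by (auto simp: mat_ac_def)
    have Mc: "?M = companion ?f" unfolding M_def mat_ac_def companion_map_poly_to_ac ..
    have df: "degree ?f = d" by (simp add: d_def)
    have f0: "?f \<noteq> 0" using f by auto
    have pM': "poly_mat ?M ?f = 0\<^sub>m d d"
      unfolding mat_ac_def poly_mat_map[OF M] pM by auto
    have pB': "poly_mat ?B ?f = 0\<^sub>m (n - d) (n - d)"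
      unfolding mat_ac_def poly_mat_map[OF B] pB by auto
    have N': "mat_ac N = four_block_mat ?M (0\<^sub>m d (n - d)) (0\<^sub>m (n - d) d) ?B"
      unfolding N_def mat_ac_def using M B by (intro eq_matI) auto
    define m where "m = (\<lambda>e. order e ?f)"
    have m_eq: "order e ?f = m e" for e by (simp add: m_def)
    \<comment> \<open>\<open>A\<close> has for every root \<open>e\<close> of \<open>f\<close> one block of size \<open>m
        e\<close> from the companion part, and no larger ones.\<close>
    have step: "nullity_step ?A e k = (if k < m e then 1 else 0) + nullity_step ?B e k" for e k
      unfolding nullity_step_similar[OF A' similar_mat_ac[OF A AN]] N' nullity_step_four_block[OF M' B']
      using nullity_step_companion[of ?f e k] pM' f(2) by (simp add: df m_def d_def flip: Mc)
    have stepB: "nullity_step ?B e k = 0" if "m e \<le> k" for e k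
      using nullity_step_beyond_order[OF B' pB' f0] that by (simp add: m_def)
    have pos: "0 < nullity_step ?A e k \<longleftrightarrow> k < m e" for e k
      using step[of e k] stepB[of e k] by (cases "k < m e") auto
    have B_eq: "nullity_step ?B e k = nullity_step ?A e k - 1" for e k
      using step[of e k] stepB[of e k] by (cases "k < m e") auto
    have "\<exists>S\<in>carrier_mat (n - d) (n - d). S * B = - (B * S) \<and> S * S = poly_mat B [:a\<^sup>2, 0, -1:]"
    proof (rule less(1)[OF dn(2) B])
      show "nullity_step ?B ?a (Suc k) \<le> nullity_step ?B (- ?a) k" for k
        unfolding B_eq using less(3)[of k] by (rule diff_le_mono)
      show "nullity_step ?B (- ?a) (Suc k) \<le> nullity_step ?B ?a k" for k
        unfolding B_eq using less(4)[of k] by (rule diff_le_mono)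
      show "nullity_step ?B e k = nullity_step ?B (- e) k" if "e \<noteq> ?a" "e \<noteq> - ?a" for e k
        unfolding B_eq using less(5)[OF that, of k] by simp
    qed
    then obtain S2 where S2: "S2 \<in> carrier_mat (n - d) (n - d)" "S2 * B = - (B * S2)"
      "S2 * S2 = poly_mat B [:a\<^sup>2, 0, -1:]" by blast
    have m_sym: "m e = m (- e)" if "e \<noteq> ?a" "e \<noteq> - ?a" for e
    proof -
      have "k < m e \<longleftrightarrow> k < m (- e)" for k using less(5)[OF that, of k] by (simp flip: pos)
      then show ?thesis by (metis linorder_neqE_nat less_irrefl)
    qed
    have m1: "m ?a \<le> Suc (m (- ?a))"
    proof (rule ccontr)
      assume "\<not> ?thesis"
      then have "0 < nullity_step ?A ?a (Suc (m (- ?a)))" by (simp add: pos)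
      with less(3)[of "m (- ?a)"] have "0 < nullity_step ?A (- ?a) (m (- ?a))" by linarith
      then show False by (simp add: pos)
    qed
    have m2: "m (- ?a) \<le> Suc (m ?a)"
    proof (rule ccontr)
      assume "\<not> ?thesis"
      then have "0 < nullity_step ?A (- ?a) (Suc (m ?a))" by (simp add: pos)
      with less(4)[of "m ?a"] have "0 < nullity_step ?A ?a (m ?a)" by linarith
      then show False by (simp add: pos)
    qed
    \<comment> \<open>The factor \<open>w\<close> must have its root at whichever of \<open>\<plusminus>a\<close> has the larger
        order in \<open>f\<close>: there \<open>f(-X)\<close> may lack one root.\<close>
    define s :: 'a where "s = (if m ?a \<le> m (- ?a) then 1 else -1)"
    define w where "w = [:a, s:]"
    have s: "s = 1 \<or> s = -1" by (simp add: s_def)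
    have s': "to_ac s = (if m ?a \<le> m (- ?a) then 1 else -1)" by (simp add: s_def)
    have ww: "w * reflect w = [:a\<^sup>2, 0, -1:]"
      using s by (auto simp: w_def pcompose_pCons power2_eq_square)
    have w': "map_poly to_ac w = [:?a, to_ac s:]" unfolding w_def by (simp only: to_ac_hom.map_poly_pCons_hom map_poly_0)
    have "to_ac s \<noteq> 0" using s by auto
    then have w0: "map_poly to_ac w \<noteq> 0" unfolding w' by simp
    have rf0: "reflect ?f \<noteq> 0" using f0 reflect_reflect[of ?f] by auto
    have ow: "1 \<le> order e (map_poly to_ac w)" if "?a + e * to_ac s = 0" for e
    proof -
      have "poly (map_poly to_ac w) e = 0" using that by (simp add: w')
      then have "order e (map_poly to_ac w) \<noteq> 0" using w0 order_root by blast
      then show ?thesis by linarith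
    qed
    \<comment> \<open>Divisibility is tested over the algebraic closure, root by root; it is only used through the matrix identity
        \<open>pw\<close>, which descends since \<open>to_ac\<close> is injective.\<close>
    have "?f dvd map_poly to_ac w * reflect ?f"
    proof (rule alg_closed_dvdI)
      fix e
      have o: "order e (map_poly to_ac w * reflect ?f) = order e (map_poly to_ac w) + m (- e)"
        using w0 rf0 by (simp add: order_mult order_reflect[OF f0] m_def)
      show "order e ?f \<le> order e (map_poly to_ac w * reflect ?f)"
        unfolding o m_eq
      proof (cases "m ?a \<le> m (- ?a)")
        case True
        then show "m e \<le> order e (map_poly to_ac w) + m (- e)"
          using m_sym[of e] m2 ow[of e] s' by (cases "e = ?a"; cases "e = - ?a") auto
      next
        case False
        then show "m e \<le> order e (map_poly to_ac w) + m (- e)"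
          using m_sym[of e] m1 ow[of e] s' by (cases "e = ?a"; cases "e = - ?a") auto
      qed
    qed (use f0 w0 rf0 in auto)
    then obtain q where q: "map_poly to_ac w * reflect ?f = ?f * q" by (rule dvdE)
    have "map_mat to_ac (poly_mat M (w * reflect f)) = poly_mat ?M (map_poly to_ac (w * reflect f))"
      unfolding mat_ac_def poly_mat_map[OF M] ..
    also have "map_poly to_ac (w * reflect f) = ?f * q"
      unfolding q[symmetric] map_poly_to_ac_reflect[symmetric] by (rule to_ac_poly_hom.hom_mult)
    also have "poly_mat ?M (?f * q) = 0\<^sub>m d d"
      unfolding poly_mat_mult[OF M'] pM' by (rule left_mult_zero_mat) (use M' in auto)
    finally have 0: "map_mat to_ac (poly_mat M (w * reflect f)) = 0\<^sub>m d d" .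
    have pw: "poly_mat M (w * reflect f) = 0\<^sub>m d d"
    proof (rule eq_matI)
      fix i j assume "i < dim_row (0\<^sub>m d d :: 'a mat)" "j < dim_col (0\<^sub>m d d :: 'a mat)"
      then have ij: "i < d" "j < d" by auto
      then have "to_ac (poly_mat M (w * reflect f) $$ (i, j)) = 0"
        using arg_cong[OF 0, of "\<lambda>Z. Z $$ (i, j)"] poly_mat_dim[OF M] by simp
      then show "poly_mat M (w * reflect f) $$ (i, j) = 0\<^sub>m d d $$ (i, j)" using ij by simp
    qed (simp_all add: poly_mat_dim[OF M])
    from companion_anticommuting[OF f(2), folded M_def d_def, OF pM pw] obtain S1 where
      S1: "S1 \<in> carrier_mat d d" "S1 * M = - (M * S1)" "S1 * S1 = poly_mat M [:a\<^sup>2, 0, -1:]"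
      unfolding ww by (elim bexE conjE)
    have U: "four_block_mat S1 (0\<^sub>m d (n - d)) (0\<^sub>m (n - d) d) S2 \<in> carrier_mat n n"
      using four_block_carrier_mat[OF S1(1) S2(1)] dn by simp
    show ?thesis
      using anticommuting_similar[OF AN A U, unfolded N_def, OF anticommuting_four_block[OF M B S1 S2]] .
  qed
qed

section \<open>The characterization\<close>

lemma sum_list_min_Suc:
  "sum_list (map (min (Suc k)) xs) = sum_list (map (min k) xs) + length (filter (\<lambda>n. k < n) xs)"
  by (induct xs) auto

definition block_sizes :: "(nat \<times> 'b) list \<Rightarrow> 'b \<Rightarrow> nat list" where
  "block_sizes n_as e = map fst [(n, e') \<leftarrow> n_as. e' = e]"

lemma nullity_step_jordan_nf:
  assumes A: "A \<in> carrier_mat n n" and j: "jordan_nf A n_as"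
  shows "nullity_step A e k = length (filter (\<lambda>n. k < n) (block_sizes n_as e))"
  unfolding nullity_step_def dim_gen_eigenspace_eq_nullity[OF A, symmetric] dim_gen_eigenspace[OF j]
    block_sizes_def[symmetric] sum_list_min_Suc by simp

lemma length_filter_block_sizes:
  "length (filter ((=) (k, e)) n_as) = length (filter ((=) k) (block_sizes n_as e))"
  unfolding block_sizes_def by (induct n_as) auto

text \<open>
  Translates between numbers of blocks of size exactly \<open>k\<close> and numbers of blocks of size greater than
  \<open>k\<close>. Entries \<open>0\<close> are invisible to both sides.
\<close>

lemma equal_counts_iff_equal_tails:
  fixes xs ys :: "nat list"
  shows "(\<forall>k\<ge>1. length (filter ((=) k) xs) = length (filter ((=) k) ys)) \<longleftrightarrow>
    (\<forall>k. length (filter (\<lambda>n. k < n) xs) = length (filter (\<lambda>n. k < n) ys))"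
proof
  assume *: "\<forall>k\<ge>1. length (filter ((=) k) xs) = length (filter ((=) k) ys)"
  show "\<forall>k. length (filter (\<lambda>n. k < n) xs) = length (filter (\<lambda>n. k < n) ys)"
  proof
    fix k
    have c: "count (mset zs) x = length (filter ((=) x) zs)" for zs :: "nat list" and x
      by (induct zs) auto
    have "filter_mset (\<lambda>n. k < n) (mset xs) = filter_mset (\<lambda>n. k < n) (mset ys)"
      using * by (intro multiset_eqI) (auto simp: c)
    from arg_cong[OF this, of size] show "length (filter (\<lambda>n. k < n) xs) = length (filter (\<lambda>n. k < n) ys)"
      by (simp flip: mset_filter)
  qed
next
  assume *: "\<forall>k. length (filter (\<lambda>n. k < n) xs) = length (filter (\<lambda>n. k < n) ys)"
  have e: "length (filter ((=) (Suc j)) zs) + length (filter (\<lambda>n. Suc j < n) zs) = length (filter (\<lambda>n. j < n) zs)" for j zs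
    by (induct zs) auto
  show "\<forall>k\<ge>1. length (filter ((=) k) xs) = length (filter ((=) k) ys)"
  proof (intro allI impI)
    fix k :: nat assume "1 \<le> k"
    then obtain j where "k = Suc j" by (cases k) auto
    then show "length (filter ((=) k) xs) = length (filter ((=) k) ys)"
      using e[of j xs] e[of j ys] * by (metis add_right_cancel)
  qed
qed

theorem theorem1:
  fixes \<alpha> :: "'a::field" and A :: "'a mat" and n :: nat
  assumes "CHAR('a) \<noteq> 2" and "\<alpha> \<noteq> 0" and "n \<ge> 1" and "A \<in> carrier_mat n n"
  shows "mat_composite n \<alpha> (- \<alpha>) A \<longleftrightarrow>
      intertwined (nk A (to_ac \<alpha>)) (nk A (to_ac (- \<alpha>))) \<and>
      (\<forall>\<mu>. \<mu> \<notin> {0, to_ac \<alpha>, to_ac (- \<alpha>)} \<longrightarrow> (\<forall>k\<ge>1. jk A \<mu> k = jk A (- \<mu>) k))"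
proof -
  let ?A = "mat_ac A" and ?a = "to_ac \<alpha>"
  note A = assms(4)
  have A': "?A \<in> carrier_mat n n" using A by (simp add: mat_ac_def)
  have two: "(2 :: 'a) \<noteq> 0" using assms(1) by (rule char_ne_2_imp_two_neq_0)
  have nk: "nk A \<mu> (Suc k) = nullity_step ?A \<mu> k" for \<mu> k
    unfolding nk_def nullity_step_def dim_gen_eigenspace_eq_nullity[OF A'] by simp
  have inter: "intertwined (nk A ?a) (nk A (to_ac (- \<alpha>))) \<longleftrightarrow>
      (\<forall>k. nullity_step ?A (- ?a) (Suc k) \<le> nullity_step ?A ?a k \<and> nullity_step ?A ?a (Suc k) \<le> nullity_step ?A (- ?a) k)"
  proof -
    have "(\<forall>k\<ge>1. P k) \<longleftrightarrow> (\<forall>k. P (Suc k))" for P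
      by (metis One_nat_def Suc_le_D Suc_le_mono le0)
    then show ?thesis unfolding intertwined_def by (simp only: Suc_eq_plus1[symmetric] nk to_ac_minus)
  qed
  obtain n_as where j: "jordan_nf ?A n_as" using jordan_nf_exists_alg_closed[OF A'] by blast
  have blocks: "(\<forall>k\<ge>1. jk A \<mu> k = jk A (- \<mu>) k) \<longleftrightarrow> (\<forall>k. nullity_step ?A \<mu> k = nullity_step ?A (- \<mu>) k)" for \<mu>
    unfolding nullity_step_jordan_nf[OF A' j] equal_counts_iff_equal_tails[symmetric]
    by (auto simp: jk_eq[OF j] length_filter_block_sizes)
  have cond: "intertwined (nk A ?a) (nk A (to_ac (- \<alpha>))) \<and>
      (\<forall>\<mu>. \<mu> \<notin> {0, ?a, to_ac (- \<alpha>)} \<longrightarrow> (\<forall>k\<ge>1. jk A \<mu> k = jk A (- \<mu>) k)) \<longleftrightarrow>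
    (\<forall>k. nullity_step ?A (- ?a) (Suc k) \<le> nullity_step ?A ?a k \<and> nullity_step ?A ?a (Suc k) \<le> nullity_step ?A (- ?a) k) \<and>
    (\<forall>\<mu>. \<mu> \<noteq> ?a \<and> \<mu> \<noteq> - ?a \<longrightarrow> (\<forall>k. nullity_step ?A \<mu> k = nullity_step ?A (- \<mu>) k))"
  proof -
    have "(\<forall>\<mu>. \<mu> \<notin> {0, ?a, - ?a} \<longrightarrow> (\<forall>k. nullity_step ?A \<mu> k = nullity_step ?A (- \<mu>) k)) \<longleftrightarrow>
      (\<forall>\<mu>. \<mu> \<noteq> ?a \<and> \<mu> \<noteq> - ?a \<longrightarrow> (\<forall>k. nullity_step ?A \<mu> k = nullity_step ?A (- \<mu>) k))" (is "?L \<longleftrightarrow> ?R")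
    proof (intro iffI allI impI)
      fix \<mu> k assume L: ?L and \<mu>: "\<mu> \<noteq> ?a \<and> \<mu> \<noteq> - ?a"
      show "nullity_step ?A \<mu> k = nullity_step ?A (- \<mu>) k"
      proof (cases "\<mu> = 0")
        case False
        with \<mu> have "\<mu> \<notin> {0, ?a, - ?a}" by blast
        then show ?thesis by (rule L[rule_format])
      qed simp
    next
      fix \<mu> k assume R: ?R and \<mu>: "\<mu> \<notin> {0, ?a, - ?a}"
      from \<mu> have "\<mu> \<noteq> ?a \<and> \<mu> \<noteq> - ?a" by blast
      then show "nullity_step ?A \<mu> k = nullity_step ?A (- \<mu>) k" by (rule R[rule_format])
    qed
    then show ?thesis unfolding to_ac_minus inter[unfolded to_ac_minus] blocks by (rule arg_cong)
  qed
  show ?thesis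
    unfolding cond
  proof
    assume "mat_composite n \<alpha> (- \<alpha>) A"
    from composite_imp_anticommuting[OF A this] obtain T where T: "T \<in> carrier_mat n n"
      "T * A = - (A * T)" "T * T = poly_mat A [:\<alpha>\<^sup>2, 0, -1:]" by blast
    define S where "S = mat_ac T"
    \<comment> \<open>The anticommuting matrix is moved to the algebraic closure, where \<open>nullity_anticommute\<close> applies
        at every eigenvalue.\<close>
    have S: "S \<in> carrier_mat n n" using T by (simp add: S_def mat_ac_def)
    have anti: "S * ?A = - (?A * S)"
    proof -
      have "S * ?A = map_mat to_ac (- (A * T))"
        unfolding S_def mat_ac_def to_ac_hom.mat_hom_mult[OF T(1) A, symmetric] T(2) ..
      also have "\<dots> = - map_mat to_ac (A * T)" by (intro eq_matI) (use A T in \<open>auto simp del: index_mult_mat(1)\<close>)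
      also have "\<dots> = - (?A * S)" unfolding S_def mat_ac_def to_ac_hom.mat_hom_mult[OF A T(1)] ..
      finally show ?thesis .
    qed
    have sq: "S * S = poly_mat ?A [:?a\<^sup>2, 0, -1:]"
    proof -
      have "map_poly to_ac [:\<alpha>\<^sup>2, 0, -1:] = [:?a\<^sup>2, 0, -1:]"
        by (simp only: to_ac_hom.map_poly_pCons_hom map_poly_0 to_ac_power to_ac_0 to_ac_minus to_ac_1)
      then show ?thesis
        unfolding S_def mat_ac_def to_ac_hom.mat_hom_mult[OF T(1) T(1), symmetric] T(3)
        by (metis poly_mat_map[OF A])
    qed
    have "(2 :: 'a alg_closure) \<noteq> 0" using two by (metis to_ac_eq_0_iff to_ac_numeral)
    then have ne: "?a \<noteq> - ?a" using assms(2) by (simp add: eq_neg_iff_add_eq_0 flip: mult_2)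
    have special: "nullity_step ?A e (Suc k) \<le> nullity_step ?A (- e) k" if "e = ?a \<or> e = - ?a" for e k
    proof -
      have e: "e\<^sup>2 = ?a\<^sup>2" "e \<noteq> - e" using that ne by auto
      from anticommuting_nullity_special[OF A' S anti sq e, of k] show ?thesis
        using nullity_power_Suc[OF A', of e "Suc k"] nullity_power_Suc[OF A', of "- e" k] by simp
    qed
    have other: "nullity_step ?A e k \<le> nullity_step ?A (- e) k" if "e \<noteq> ?a" "e \<noteq> - ?a" for e k
      using anticommuting_nullity_other[OF A' S anti sq that, of k]
        nullity_power_Suc[OF A', of e k] nullity_power_Suc[OF A', of "- e" k] by simp
    show "(\<forall>k. nullity_step ?A (- ?a) (Suc k) \<le> nullity_step ?A ?a k \<and> nullity_step ?A ?a (Suc k) \<le> nullity_step ?A (- ?a) k) \<and>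
      (\<forall>\<mu>. \<mu> \<noteq> ?a \<and> \<mu> \<noteq> - ?a \<longrightarrow> (\<forall>k. nullity_step ?A \<mu> k = nullity_step ?A (- \<mu>) k))"
    proof (intro conjI allI impI)
      fix k
      show "nullity_step ?A (- ?a) (Suc k) \<le> nullity_step ?A ?a k" using special[of "- ?a" k] by simp
      show "nullity_step ?A ?a (Suc k) \<le> nullity_step ?A (- ?a) k" using special[of ?a k] by simp
    next
      fix \<mu> k assume \<mu>: "\<mu> \<noteq> ?a \<and> \<mu> \<noteq> - ?a"
      then have "- \<mu> \<noteq> ?a" "- \<mu> \<noteq> - ?a" using minus_equation_iff[of \<mu> ?a] by auto
      from other[OF this, of k] other[of \<mu> k] \<mu> show "nullity_step ?A \<mu> k = nullity_step ?A (- \<mu>) k" by simp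
    qed
  next
    assume c: "(\<forall>k. nullity_step ?A (- ?a) (Suc k) \<le> nullity_step ?A ?a k \<and> nullity_step ?A ?a (Suc k) \<le> nullity_step ?A (- ?a) k) \<and>
      (\<forall>\<mu>. \<mu> \<noteq> ?a \<and> \<mu> \<noteq> - ?a \<longrightarrow> (\<forall>k. nullity_step ?A \<mu> k = nullity_step ?A (- \<mu>) k))"
    have "\<exists>S\<in>carrier_mat n n. S * A = - (A * S) \<and> S * S = poly_mat A [:\<alpha>\<^sup>2, 0, -1:]"
      by (rule ex_anticommuting[OF A]) (use c in auto)
    then show "mat_composite n \<alpha> (- \<alpha>) A"
      using anticommuting_imp_composite[OF A _ _ _ assms(2) two] by blast
  qed
qed

end
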